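(* Let $\mathbf{T}=(T_t\colon t\ge 0)$ be a subordinator with the Laplace exponent $\phi$ and let $p(t,\cdot)$ be the density of $T_t$. Suppose that $-\phi''\in\mathrm{WLSC}(\alpha-2,c,x_0)$ for some $c\in(0,1]$, $x_0\ge 0$, and $\alpha>0$. Assume also that $b=0$. Then for any $x>0$, $$\lim_{t\to\infty}p(t,x)\sqrt{t(-\phi''(w))}\,\exp\big\{t\big(\phi(w)-w\phi'(w)\big)\big\}=(2\pi)^{-1/2},$$ where $w=(\phi')^{-1}(x/t)$.
   Context: A subordinator is a one-dimensional Lévy process $\mathbf{T}=(T_t\colon t\ge 0)$ with $T_0=0$ and nondecreasing paths. Its Laplace exponent $\phi\colon[0,\infty)\to[0,\infty)$ is defined by $\mathbb{E}\,e^{-\lambda T_t}=e^{-t\phi(\lambda)}$, and $\phi(\lambda)=b\lambda+\int_{(0,\infty)}(1-e^{-\lambda s})\,\nu(\mathrm{d}s)$, where $b\ge 0$ and $\nu$ (the Lévy measure) satisfies $\int_{(0,\infty)}\min\{1,s\}\,\nu(\mathrm{d}s)<\infty$. It is assumed that $\phi''\not\equiv 0$. Under the hypotheses of the claim $T_t$ has a density for every $t>0$, and $p(t,\cdot)$ denotes its continuous version. $(\phi')^{-1}$ is the inverse function of the strictly decreasing function $\phi'$ (so $w$ is defined for all $t$ large enough). For $\tau\in\mathbb{R}$, $c\in(0,1]$, $x_0\ge 0$, a nonnegative function $f$ on $(0,\infty)$ belongs to $\mathrm{WLSC}(\tau,c,x_0)$ if $f(\lambda x)\ge c\lambda^{\tau}f(x)$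 for all $\lambda\ge 1$ and $x>x_0$. *)

theory Defs
  imports "HOL-Probability.Probability"
begin

text \<open>Processes are indexed by real times; only the times \<open>t \<ge> 0\<close> are relevant, and \<open>X t\<close> is
  unconstrained for \<open>t < 0\<close>.  Path regularity enters as continuity in probability, which holds for
  every process with right-continuous paths, independent and stationary increments.\<close>

definition levy_process :: "'a measure \<Rightarrow> (real \<Rightarrow> 'a \<Rightarrow> real) \<Rightarrow> bool" where
  "levy_process M X \<longleftrightarrow>
     prob_space M \<and>
     (\<forall>t\<ge>0. X t \<in> borel_measurable M) \<and>
     (AE \<omega> in M. X 0 \<omega> = 0) \<and>
     (\<forall>(n::nat) (s::nat \<Rightarrow> real). 0 \<le> s 0 \<longrightarrow> (\<forall>i<n. s i \<le> s (Suc i)) \<longrightarrow>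
        prob_space.indep_vars M (\<lambda>_. borel) (\<lambda>i \<omega>. X (s (Suc i)) \<omega> - X (s i) \<omega>) {..<n}) \<and>
     (\<forall>s\<ge>0. \<forall>h\<ge>0. distr M borel (\<lambda>\<omega>. X (s + h) \<omega> - X s \<omega>) = distr M borel (X h)) \<and>
     (\<forall>t\<ge>0. \<forall>\<epsilon>>0. ((\<lambda>s. measure M {\<omega> \<in> space M. \<bar>X s \<omega> - X t \<omega>\<bar> > \<epsilon>}) \<longlongrightarrow> 0)
                        (at t within {0..}))"

definition subordinator :: "'a measure \<Rightarrow> (real \<Rightarrow> 'a \<Rightarrow> real) \<Rightarrow> bool" where
  "subordinator M T \<longleftrightarrow> levy_process M T \<and> (AE \<omega> in M. mono_on {0..} (\<lambda>t. T t \<omega>))"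

text \<open>The Laplace exponent is a function on \<open>[0, \<infinity>)\<close>; its values at negative arguments are
  arbitrary, and its derivatives are only used at positive arguments.\<close>

definition laplace_exponent :: "'a measure \<Rightarrow> (real \<Rightarrow> 'a \<Rightarrow> real) \<Rightarrow> (real \<Rightarrow> real) \<Rightarrow> bool" where
  "laplace_exponent M T \<phi> \<longleftrightarrow>
     (\<forall>t\<ge>0. \<forall>l\<ge>0. (\<integral>\<omega>. exp (- l * T t \<omega>) \<partial>M) = exp (- t * \<phi> l))"

text \<open>A measure on \<open>(0, \<infinity>)\<close> is encoded as a Borel measure on the real line that does not charge
  \<open>(-\<infinity>, 0]\<close>.\<close>

definition levy_measure :: "real measure \<Rightarrow> bool" where
  "levy_measure \<nu> \<longleftrightarrow>
     sets \<nu> = sets borel \<and> emeasure \<nu> {..0} = 0 \<and> set_integrable \<nu> {0<..} (\<lambda>s. min 1 s)"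

definition levy_khintchine :: "(real \<Rightarrow> real) \<Rightarrow> real \<Rightarrow> real measure \<Rightarrow> bool" where
  "levy_khintchine \<phi> b \<nu> \<longleftrightarrow>
     b \<ge> 0 \<and> levy_measure \<nu> \<and>
     (\<forall>l\<ge>0. \<phi> l = b * l + (LINT s:{0<..}|\<nu>. 1 - exp (- l * s)))"

definition WLSC :: "real \<Rightarrow> real \<Rightarrow> real \<Rightarrow> (real \<Rightarrow> real) set" where
  "WLSC \<tau> c x0 =
     {f. (\<forall>x>0. f x \<ge> 0) \<and> (\<forall>l\<ge>1. \<forall>x>x0. f (l * x) \<ge> c * l powr \<tau> * f x)}"

definition is_continuous_density :: "'a measure \<Rightarrow> ('a \<Rightarrow> real) \<Rightarrow> (real \<Rightarrow> real) \<Rightarrow> bool" where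
  "is_continuous_density M X f \<longleftrightarrow>
     continuous_on UNIV f \<and> (\<forall>x. f x \<ge> 0) \<and> distributed M lborel X (\<lambda>x. ennreal (f x))"

lemma is_continuous_density_unique:
  assumes "is_continuous_density M X f" "is_continuous_density M X g"
  shows "f = g"
proof -
  have cont: "continuous_on UNIV f" "continuous_on UNIV g"
    and nonneg: "\<And>x. f x \<ge> 0" "\<And>x. g x \<ge> 0"
    and distr: "distributed M lborel X (\<lambda>x. ennreal (f x))"
               "distributed M lborel X (\<lambda>x. ennreal (g x))"
    using assms by (auto simp: is_continuous_density_def)
  have "AE x in lborel. ennreal (f x) = ennreal (g x)"
    using distr sigma_finite_measure.density_unique[OF sigma_finite_lborel]
    unfolding distributed_def by metis
  then have ae: "AE x in lborel. x \<notin> {x. f x \<noteq> g x}"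
    by eventually_elim (use nonneg in auto)
  have op: "open {x. f x \<noteq> g x}"
    using cont by (intro open_Collect_neq) auto
  then have "{x. f x \<noteq> g x} \<in> null_sets lborel"
    using ae by (subst AE_iff_null_sets) auto
  then have "{x. f x \<noteq> g x} = {}"
    using op by (metis open_not_negligible negligible_iff_null_sets null_sets_completionI)
  then show ?thesis by auto
qed

text \<open>The continuous version of the density of \<open>X\<close>: by the preceding lemma it is unique whenever it
  exists (otherwise the value is unspecified).\<close>

definition continuous_density :: "'a measure \<Rightarrow> ('a \<Rightarrow> real) \<Rightarrow> real \<Rightarrow> real" where
  "continuous_density M X = (THE f. is_continuous_density M X f)"

end

theory Submission
  imports Defs "HOL-Complex_Analysis.Complex_Analysis" "HOL-Real_Asymp.Real_Asymp"
begin

text \<open>The proof is a saddle point argument in probabilistic form. Fix \<open>w > 0\<close> and tilt the law of \<open>T t\<close>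
  by the density \<open>exp (t * \<phi> w - w * s)\<close>. The Laplace transform of \<open>T t\<close> extends analytically to the
  right half-plane, so the tilted law has characteristic function
  \<open>exp (t * (\<phi> w - \<phi> (w - \<i> * u)))\<close> (lemma \<open>complex_laplace_transform\<close>). When this is integrable,
  Fourier inversion gives the continuous density of the tilted law, hence that of \<open>T t\<close>
  (\<open>density_inversion_density\<close>, \<open>tilted_continuous_density\<close>); no contour has to be shifted. The choice
  \<open>\<phi>' (w) = x / t\<close> makes \<open>x\<close> the mean of the tilted law, so the linear term of the exponent cancels.
  After the substitution \<open>u = y / sqrt (t * (- \<phi>'' (w)))\<close> the expression in the theorem is
  \<open>1 / (2 * \<pi>)\<close> times the integral over \<open>y\<close> of \<open>exp (E t y)\<close> with
  \<open>E t y = t * (LINT s|\<nu>. exp (- w * s) * (exp (\<i> * u * s) - 1 - \<i> * u * s))\<close>,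
  and it remains to see that this integral tends to the Gaussian one.

  Since the drift vanishes, \<open>\<phi>'\<close> tends to \<open>0\<close> at infinity and \<open>w\<close> tends to infinity with \<open>t\<close>.
  Weak lower scaling then gives \<open>- w\<^sup>2 * \<phi>'' (w) \<longlongrightarrow> \<infinity>\<close>. The second-order term of \<open>E t y\<close> is exactly
  \<open>- y\<^sup>2 / 2\<close>, and the third-order remainder is of order
  \<open>\<bar>y\<bar>\<^sup>3 / (w * sqrt (t * (- \<phi>'' (w))))\<close> (\<open>moment_3_le\<close>, \<open>scaled_cgf_tendsto\<close>). For dominated
  convergence one needs a lower bound for the integral of
  \<open>exp (- w * s) * (1 - cos (\<theta> * s))\<close>; it comes from jumps of size at most
  \<open>1 / max w \<bar>\<theta>\<bar>\<close>, whose truncated second moment is comparable to \<open>- \<phi>''\<close> by weak lower scaling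
  alone (\<open>truncated_moment_ge\<close>, \<open>tilted_cos_lower_bound\<close>, \<open>norm_exp_scaled_cgf_le\<close>).\<close>

section \<open>Fourier inversion for integrable characteristic functions\<close>

lemma integral_Icc_iexp:
  fixes a b t :: real
  assumes "a \<le> b" "t \<noteq> 0"
  shows "(CLBINT x. indicator {a..b} x *\<^sub>R iexp (- (t * x))) =
         (iexp (- (t * a)) - iexp (- (t * b))) / (\<i> * t)"
proof -
  have "(CLBINT x. indicator {a..b} x *\<^sub>R iexp (- (t * x)))
      = - iexp (- (t * b)) / (\<i> * t) - (- iexp (- (t * a)) / (\<i> * t))"
  proof (rule integral_FTC_atLeastAtMost[OF assms(1)])
    fix x :: real
    have "((\<lambda>z. - exp (\<i> * - (t * z)) / (\<i> * t)) has_field_derivative exp (\<i> * - (t * x))) (at (complex_of_real x))"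
      using assms(2) by (auto intro!: derivative_eq_intros simp: field_simps)
    then show "((\<lambda>x. - iexp (- (t * x)) / (\<i> * t)) has_vector_derivative iexp (- (t * x))) (at x within {a..b})"
      by (auto dest: has_vector_derivative_real_field)
  qed (auto intro!: continuous_intros)
  then show ?thesis by (simp add: diff_divide_distrib)
qed

text \<open>The Fourier inversion integral of the characteristic function of \<open>M\<close>. For a real measure that
  integral is real whenever it converges absolutely; taking the real part makes the type real. The
  value is meaningful only when \<open>char M\<close> is integrable.\<close>

definition inversion_density :: "real measure \<Rightarrow> real \<Rightarrow> real" where
  "inversion_density M x = Re (CLBINT u. iexp (- (u * x)) * char M u) / (2 * pi)"

context real_distribution
begin

context
  assumes char_integrable: "integrable lborel (char M)"
begin

lemma isCont_inversion_integral: "isCont (\<lambda>x::real. CLBINT u. iexp (- (u * x)) * char M u) x"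
  proof (rule continuous_at_sequentiallyI)
    fix X :: "nat \<Rightarrow> real" assume X: "X \<longlonglongrightarrow> x"
    show "(\<lambda>n. CLBINT u. iexp (- (u * X n)) * char M u) \<longlonglongrightarrow> (CLBINT u. iexp (- (u * x)) * char M u)"
    proof (rule integral_dominated_convergence[where w = "\<lambda>u. norm (char M u)"])
      show "AE u in lborel. (\<lambda>n. iexp (- (u * X n)) * char M u) \<longlonglongrightarrow> iexp (- (u * x)) * char M u"
        using X by (intro AE_I2 tendsto_intros) auto
    qed (use char_integrable in \<open>auto simp: norm_mult\<close>)
qed

lemma continuous_inversion_density: "continuous_on UNIV (inversion_density M)"
proof -
  have "isCont (inversion_density M) x" for x
    using isCont_inversion_integral[of x] unfolding inversion_density_def
    by (intro continuous_intros) (auto intro!: continuous_Re)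
  then show ?thesis by (simp add: continuous_at_imp_continuous_on)
qed

lemma inversion_density_bound: "\<bar>inversion_density M x\<bar> \<le> (LBINT u. norm (char M u)) / (2 * pi)"
proof -
  have "\<bar>Re (CLBINT u. iexp (- (u * x)) * char M u)\<bar> \<le> norm (CLBINT u. iexp (- (u * x)) * char M u)"
    by (rule abs_Re_le_cmod)
  also have "\<dots> \<le> (LBINT u. norm (iexp (- (u * x)) * char M u))"
    by (rule integral_norm_bound)
  finally show ?thesis by (simp add: inversion_density_def divide_right_mono norm_mult)
qed

text \<open>Levy's inversion formula expresses the measure of an interval as the limit of the integrals over
  \<open>[-n, n]\<close> of the transform of the interval times \<open>char M\<close>. Absolute integrability of \<open>char M\<close>
  turns this limit into an integral over the line, and Fubini moves the interval outside.\<close>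

lemma measure_Ioc_no_atoms:
  assumes ab: "a \<le> b" and "measure M {a} = 0" "measure M {b} = 0"
  shows "measure M {a<..b} = (LBINT x. indicator {a..b} x * inversion_density M x)"
proof -
  define F where "F = (\<lambda>t::real. CLBINT x. indicator {a..b} x *\<^sub>R iexp (- (t * x)))"
  have F_meas [measurable]: "F \<in> borel_measurable borel"
    unfolding F_def by measurable
  have F_bound: "norm (F t) \<le> b - a" for t
  proof -
    have "norm (F t) \<le> (LBINT x. norm (indicator {a..b} x *\<^sub>R iexp (- (t * x))))"
      unfolding F_def by (rule integral_norm_bound)
    also have "\<dots> = (LBINT x. indicator {a..b} x)"
      by (intro Bochner_Integration.integral_cong) (auto simp: indicator_def)
    finally show ?thesis using ab by simp
  qed
  have Fchar: "complex_integrable lborel (\<lambda>t. F t * char M t)"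
    by (rule Bochner_Integration.integrable_bound[of _ "\<lambda>t. (b - a) * norm (char M t)"])
       (use char_integrable F_bound ab in \<open>auto simp: norm_mult intro!: mult_right_mono\<close>)
  have lim1: "(\<lambda>T::nat. CLBINT t. indicator {-real T<..<real T} t *\<^sub>R (F t * char M t))
        \<longlonglongrightarrow> (CLBINT t. F t * char M t)"
  proof (rule integral_dominated_convergence[where w = "\<lambda>t. norm (F t * char M t)"])
    show "AE t in lborel. (\<lambda>T::nat. indicator {-real T<..<real T} t *\<^sub>R (F t * char M t)) \<longlonglongrightarrow> F t * char M t"
    proof (rule AE_I2, rule tendsto_eventually)
      fix t :: real
      obtain N :: nat where "\<bar>t\<bar> < N" using reals_Archimedean2 by blast
      then show "\<forall>\<^sub>F T in sequentially. indicator {-real T<..<real T} t *\<^sub>R (F t * char M t) = F t * char M t"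
        unfolding eventually_sequentially by (intro exI[of _ N]) (auto simp: indicator_def)
    qed
  qed (use Fchar in \<open>auto simp: indicator_def\<close>)
  have "(CLBINT t=-real T..real T. (iexp (-(t * a)) - iexp (-(t * b))) / (\<i> * t) * char M t)
      = (CLBINT t. indicator {-real T<..<real T} t *\<^sub>R (F t * char M t))" for T :: nat
  proof -
    have *: "AE t in lborel. t \<noteq> (0::real)" by (rule AE_lborel_singleton)
    have F_eq: "(iexp (-(t * a)) - iexp (-(t * b))) / (\<i> * t) * char M t = F t * char M t" if "t \<noteq> 0" for t :: real
      by (simp only: F_def integral_Icc_iexp[OF ab that])
    have "einterval (- real T) (real T) = {-real T<..<real T}" and "ereal (- real T) \<le> ereal (real T)"
      by auto
    then have "(CLBINT t=-real T..real T. (iexp (-(t * a)) - iexp (-(t * b))) / (\<i> * t) * char M t)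
      = (CLBINT t. indicator {-real T<..<real T} t *\<^sub>R ((iexp (-(t * a)) - iexp (-(t * b))) / (\<i> * t) * char M t))"
      unfolding interval_lebesgue_integral_def set_lebesgue_integral_def by (simp only: if_True)
    also have "\<dots> = (CLBINT t. indicator {-real T<..<real T} t *\<^sub>R (F t * char M t))"
    proof (rule integral_cong_AE)
      show "AE t in lborel. indicator {-real T<..<real T} t *\<^sub>R ((iexp (-(t * a)) - iexp (-(t * b))) / (\<i> * t) * char M t)
          = indicator {-real T<..<real T} t *\<^sub>R (F t * char M t)"
        using * by eventually_elim (simp only: F_eq not_False_eq_True)
    qed measurable
    finally show ?thesis .
  qed
  with Levy_Inversion[OF ab assms(2,3)] lim1 have
    "measure M {a<..b} = 1 / (2 * pi) * (CLBINT t. F t * char M t)"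
    using tendsto_mult[OF tendsto_const[of "complex_of_real (1 / (2 * pi))"] lim1]
    by (intro LIMSEQ_unique) auto
  also have "(CLBINT t. F t * char M t) =
      (CLBINT t. CLBINT x. indicator {a..b} x *\<^sub>R (iexp (- (t * x)) * char M t))"
    unfolding F_def by (simp flip: integral_mult_left_zero)
  also have "\<dots> = (CLBINT x. CLBINT t. indicator {a..b} x *\<^sub>R (iexp (- (t * x)) * char M t))"
  proof (rule lborel_pair.Fubini_integral[symmetric], rule lborel_pair.Fubini_integrable)
    show "integrable lborel (\<lambda>t. LBINT x. norm (case (t, x) of (t, x) \<Rightarrow> indicator {a..b} x *\<^sub>R (iexp (- (t * x)) * char M t)))"
      using char_integrable by (simp add: norm_mult)
    show "AE t in lborel. integrable lborel (\<lambda>x. case (t, x) of (t, x) \<Rightarrow> indicator {a..b} x *\<^sub>R (iexp (- (t * x)) * char M t))"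
    proof (rule AE_I2)
      fix t :: real
      have "continuous_on {a..b} (\<lambda>x. iexp (- (t * x)) * char M t)"
        by (intro continuous_intros)
      from borel_integrable_atLeastAtMost'[OF this]
      show "integrable lborel (\<lambda>x. case (t, x) of (t, x) \<Rightarrow> indicator {a..b} x *\<^sub>R (iexp (- (t * x)) * char M t))"
        by (simp add: set_integrable_def)
    qed
  qed measurable
  also have "\<dots> = (CLBINT x. indicator {a..b} x *\<^sub>R (CLBINT t. iexp (- (t * x)) * char M t))"
    by (simp only: integral_scaleR_right)
  finally have "Re (measure M {a<..b}) = Re (1 / (2 * pi) * (CLBINT x. indicator {a..b} x *\<^sub>R (CLBINT t. iexp (- (t * x)) * char M t)))"
    by (rule arg_cong)
  then have "measure M {a<..b} = Re (1 / (2 * pi) * (CLBINT x. indicator {a..b} x *\<^sub>R (CLBINT t. iexp (- (t * x)) * char M t)))"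
    by simp
  also have "\<dots> = (LBINT x. indicator {a..b} x * inversion_density M x)"
  proof -
    have "continuous_on {a..b} (\<lambda>x. CLBINT t. iexp (- (t * x)) * char M t)"
      by (intro continuous_at_imp_continuous_on ballI isCont_inversion_integral)
    from borel_integrable_atLeastAtMost'[OF this]
    have "complex_integrable lborel (\<lambda>x. indicator {a..b} x *\<^sub>R (CLBINT t. iexp (- (t * x)) * char M t))"
      by (simp add: set_integrable_def)
    from integral_Re[OF this]
    have "Re (CLBINT x. indicator {a..b} x *\<^sub>R (CLBINT t. iexp (- (t * x)) * char M t))
        = (LBINT x. indicator {a..b} x * Re (CLBINT t. iexp (- (t * x)) * char M t))"
      by simp
    moreover have "Re (1 / (2 * pi) * z) = Re z / (2 * pi)" for z
      using Re_divide_of_real[of z "2 * pi"] by simp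
    ultimately show ?thesis
      unfolding inversion_density_def times_divide_eq_right by simp
  qed
  finally show ?thesis .
qed

text \<open>The endpoint condition of the inversion formula is void: an atom lies in arbitrarily short
  intervals with atom-free endpoints, whose measure is at most a constant times their length.\<close>

lemma measure_singleton_eq_0: "measure M {x} = 0"
proof -
  define C where "C = (LBINT u. norm (char M u)) / (2 * pi)"
  have C: "0 \<le> C" by (simp add: C_def)
  have "measure M {x} \<le> 2 * C * e" if e: "e > 0" for e
  proof -
    have count: "countable {x. measure M {x} \<noteq> 0}" by (rule countable_support)
    obtain a where a: "measure M {a} = 0" "x - e < a" "a < x"
      using open_minus_countable[OF count, of "{x - e <..< x}"] e by auto
    obtain b where b: "measure M {b} = 0" "x < b" "b < x + e"
      using open_minus_countable[OF count, of "{x <..< x + e}"] e by auto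
    have "measure M {x} \<le> measure M {a<..b}"
      using a b by (intro finite_measure_mono) auto
    also have "\<dots> = (LBINT x. indicator {a..b} x * inversion_density M x)"
      using a b by (intro measure_Ioc_no_atoms) auto
    also have "\<dots> \<le> (LBINT x. indicator {a..b} x * C)"
    proof (rule integral_mono)
      show "integrable lborel (\<lambda>x. indicator {a..b} x * inversion_density M x)"
        using borel_integrable_atLeastAtMost'[of a b "inversion_density M"] continuous_inversion_density
        by (auto simp: set_integrable_def intro: continuous_on_subset)
      show "indicator {a..b} x * inversion_density M x \<le> indicator {a..b} x * C" for x
        using inversion_density_bound[of x] by (auto simp: C_def indicator_def)
    qed (auto intro!: integrable_mult_left integrable_real_indicator simp: emeasure_lborel_Icc_eq)
    also have "\<dots> = (b - a) * C" using a b by simp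
    also have "\<dots> \<le> 2 * e * C" using a b C by (intro mult_right_mono) auto
    finally show ?thesis by (simp add: mult_ac)
  qed
  from this[of "measure M {x} / (2 * C + 1)"] show ?thesis
    using C measure_nonneg[of M "{x}"]
    by (cases "measure M {x} = 0") (auto simp: field_simps zero_less_measure_iff mult_less_0_iff)
qed

lemma measure_Ioc: "a \<le> b \<Longrightarrow> measure M {a<..b} = (LBINT x. indicator {a..b} x * inversion_density M x)"
  by (rule measure_Ioc_no_atoms) (auto simp: measure_singleton_eq_0)

lemma integrable_Icc_inversion_density: "integrable lborel (\<lambda>x. indicator {a..b} x * inversion_density M x)"
  using borel_integrable_atLeastAtMost'[of a b "inversion_density M"] continuous_inversion_density
  by (auto simp: set_integrable_def intro: continuous_on_subset)

lemma inversion_density_nonneg: "inversion_density M x \<ge> 0"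
proof (rule ccontr)
  assume "\<not> ?thesis"
  then have neg: "inversion_density M x < 0" by simp
  have "isCont (inversion_density M) x"
    using continuous_inversion_density by (simp add: continuous_on_eq_continuous_at)
  then have "\<forall>\<^sub>F y in at x. inversion_density M y < inversion_density M x / 2"
    unfolding isCont_def using neg by (intro order_tendstoD) auto
  then obtain d where d: "d > 0" "\<And>y. y \<noteq> x \<Longrightarrow> dist y x < d \<Longrightarrow> inversion_density M y < inversion_density M x / 2"
    unfolding eventually_at by auto
  define e where "e = d / 2"
  have e: "e > 0" "\<And>y. y \<in> {x..x+e} \<Longrightarrow> inversion_density M y \<le> inversion_density M x / 2"
    using d neg
    subgoal by (simp add: e_def)
    subgoal for y using d(2)[of y] d(1) neg by (cases "y = x") (auto simp: e_def dist_real_def)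
    done
  have "0 \<le> measure M {x<..x+e}" by simp
  also have "\<dots> = (LBINT y. indicator {x..x+e} y * inversion_density M y)"
    using e by (intro measure_Ioc) auto
  also have "\<dots> \<le> (LBINT y. indicator {x..x+e} y * (inversion_density M x / 2))"
    using e by (intro integral_mono integrable_Icc_inversion_density integrable_mult_left integrable_real_indicator)
      (auto simp: indicator_def)
  also have "\<dots> = e * (inversion_density M x / 2)" using e by simp
  also have "\<dots> < 0" using e neg by (simp add: mult_pos_neg)
  finally show False by simp
qed

lemma density_inversion_density: "M = density lborel (\<lambda>x. ennreal (inversion_density M x))"
proof (rule measure_eqI_generator_eq[where \<Omega>=UNIV])
  have [measurable]: "inversion_density M \<in> borel_measurable borel"
    using continuous_inversion_density by (rule borel_measurable_continuous_onI)
  fix X assume "X \<in> range (\<lambda>(a, b). {a<..b::real})"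
  then obtain a b where Xeq: "X = {a<..b}" by auto
  show "emeasure M X = emeasure (density lborel (\<lambda>x. ennreal (inversion_density M x))) X"
  proof (cases "a \<le> b")
    case True
    have "emeasure M X = ennreal (LBINT x. indicator {a..b} x * inversion_density M x)"
      by (simp add: emeasure_eq_measure Xeq measure_Ioc[OF True])
    also have "\<dots> = (\<integral>\<^sup>+x. ennreal (indicator {a..b} x * inversion_density M x) \<partial>lborel)"
      by (intro nn_integral_eq_integral[symmetric] integrable_Icc_inversion_density)
        (auto simp: inversion_density_nonneg)
    also have "\<dots> = (\<integral>\<^sup>+x. ennreal (inversion_density M x) * indicator X x \<partial>lborel)"
    proof (rule nn_integral_cong_AE)
      show "AE x in lborel. ennreal (indicator {a..b} x * inversion_density M x) = ennreal (inversion_density M x) * indicator X x"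
        using AE_lborel_singleton[of a] by eventually_elim (auto simp: Xeq indicator_def)
    qed
    also have "\<dots> = emeasure (density lborel (\<lambda>x. ennreal (inversion_density M x))) X"
      by (simp add: emeasure_density Xeq)
    finally show ?thesis .
  qed (simp add: Xeq)
next
  show "(\<Union>i. {- real (i::nat)<..real i}) = UNIV"
    by (rule UN_Ioc_eq_UNIV)
qed (auto simp: borel_sigma_sets_Ioc Int_stable_def)

end

end

section \<open>Laplace exponents and tilted moments of a Levy measure\<close>

text \<open>Differentiation under the integral sign, for real and for complex parameters at once.\<close>

lemma has_field_derivative_integral:
  fixes F F' :: "'a::{real_normed_field, banach, second_countable_topology} \<Rightarrow> 'b \<Rightarrow> 'a"
  assumes "r > 0"
    and int: "\<And>z. z \<in> ball z0 r \<Longrightarrow> integrable M (F z)"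
    and meas: "F' z0 \<in> borel_measurable M"
    and deriv: "AE s in M. \<forall>z\<in>ball z0 r. ((\<lambda>z. F z s) has_field_derivative F' z s) (at z) \<and> norm (F' z s) \<le> B s"
    and B: "integrable M B"
  shows "((\<lambda>z. \<integral>s. F z s \<partial>M) has_field_derivative (\<integral>s. F' z0 s \<partial>M)) (at z0)"
proof -
  have z0: "z0 \<in> ball z0 r" using assms(1) by simp
  have "((\<lambda>z. ((\<integral>s. F z s \<partial>M) - (\<integral>s. F z0 s \<partial>M)) / (z - z0)) \<longlongrightarrow> (\<integral>s. F' z0 s \<partial>M)) (at z0 within ball z0 r)"
    unfolding tendsto_at_iff_sequentially
  proof (intro allI impI)
    fix X :: "nat \<Rightarrow> 'a" assume X: "\<forall>i. X i \<in> ball z0 r - {z0}" "X \<longlonglongrightarrow> z0"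
    have "(\<lambda>i. \<integral>s. (F (X i) s - F z0 s) / (X i - z0) \<partial>M) \<longlonglongrightarrow> (\<integral>s. F' z0 s \<partial>M)"
    proof (rule integral_dominated_convergence[where w = B])
      show "AE s in M. (\<lambda>i. (F (X i) s - F z0 s) / (X i - z0)) \<longlonglongrightarrow> F' z0 s"
        using deriv
      proof eventually_elim
        case (elim s)
        then have "((\<lambda>z. F z s) has_field_derivative F' z0 s) (at z0)" using z0 by blast
        then have "((\<lambda>z. (F z s - F z0 s) / (z - z0)) \<longlongrightarrow> F' z0 s) (at z0)"
          by (simp add: has_field_derivative_iff)
        then show ?case
          using X by (auto simp: tendsto_at_iff_sequentially o_def)
      qed
      show "AE s in M. norm ((F (X i) s - F z0 s) / (X i - z0)) \<le> B s" for i
        using deriv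
      proof eventually_elim
        case (elim s)
        have "norm (F (X i) s - F z0 s) \<le> B s * norm (X i - z0)"
          by (rule field_differentiable_bound[of "ball z0 r" "\<lambda>z. F z s" "\<lambda>z. F' z s"])
            (use elim X z0 in \<open>auto intro: has_field_derivative_at_within\<close>)
        then show ?case using X by (simp add: norm_divide divide_le_eq)
      qed
      show "(\<lambda>s. (F (X i) s - F z0 s) / (X i - z0)) \<in> borel_measurable M" for i
        using X(1) z0 int by (intro borel_measurable_divide borel_measurable_diff borel_measurable_integrable) auto
    qed (use meas B in auto)
    also have "(\<lambda>i. \<integral>s. (F (X i) s - F z0 s) / (X i - z0) \<partial>M) =
        (\<lambda>i. ((\<integral>s. F (X i) s \<partial>M) - (\<integral>s. F z0 s \<partial>M)) / (X i - z0))"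
    proof
      fix i
      show "(\<integral>s. (F (X i) s - F z0 s) / (X i - z0) \<partial>M) = ((\<integral>s. F (X i) s \<partial>M) - (\<integral>s. F z0 s \<partial>M)) / (X i - z0)"
        using X(1) int z0 by (subst Bochner_Integration.integral_diff[symmetric]) auto
    qed
    finally show "((\<lambda>z. ((\<integral>s. F z s \<partial>M) - (\<integral>s. F z0 s \<partial>M)) / (z - z0)) \<circ> X) \<longlonglongrightarrow> (\<integral>s. F' z0 s \<partial>M)"
      by (simp add: o_def)
  qed
  then show ?thesis
    using assms(1) by (simp add: has_field_derivative_iff at_within_open[OF z0])
qed

lemma power_times_exp_le:
  fixes a s :: real
  assumes "a > 0" "s \<ge> 0"
  shows "s ^ n * exp (- (a * s)) \<le> fact n / a ^ n"
proof -
  have "(a * s) ^ n / fact n \<le> exp (a * s)"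
    using sum_le_suminf[OF summable_exp[of "a * s"], of "{n}"] assms
    by (simp add: exp_def field_simps)
  then show ?thesis using assms by (simp add: exp_minus field_simps power_mult_distrib)
qed

text \<open>Since \<open>\<nu>\<close> does not charge \<open>(-\<infinity>, 0]\<close>, integrals over \<open>(0, \<infinity>)\<close> are
  written as integrals over the whole line.\<close>

locale levy_measure_space =
  fixes \<nu> :: "real measure"
  assumes levy: "levy_measure \<nu>"
begin

lemma sets_levy [measurable_cong, simp]: "sets \<nu> = sets borel"
  using levy by (simp add: levy_measure_def)

lemma AE_pos: "AE s in \<nu>. s > 0"
proof (rule AE_I')
  show "{..0} \<in> null_sets \<nu>" using levy by (auto simp: levy_measure_def null_sets_def)
qed (auto simp: not_less)

lemma integrable_min: "integrable \<nu> (\<lambda>s. min 1 s)"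
proof -
  have "integrable \<nu> (\<lambda>s. indicator {0<..} s *\<^sub>R min 1 s)"
    using levy by (simp add: levy_measure_def set_integrable_def)
  then show ?thesis
    by (rule integrable_cong_AE_imp) (use AE_pos in \<open>auto elim!: eventually_mono\<close>)
qed

lemma set_integral_eq: 
  fixes f :: "real \<Rightarrow> 'b::{banach,second_countable_topology}"
  assumes "f \<in> borel_measurable borel"
  shows "(LINT s:{0<..}|\<nu>. f s) = (LINT s|\<nu>. f s)"
  unfolding set_lebesgue_integral_def
  by (rule integral_cong_AE) (use assms AE_pos in \<open>auto elim!: eventually_mono\<close>)

lemma integrable_moment:
  assumes "n \<ge> 1" "a > 0"
  shows "integrable \<nu> (\<lambda>s. s ^ n * exp (- (a * s)))"
proof (rule Bochner_Integration.integrable_bound)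
  show "integrable \<nu> (\<lambda>s. (1 + fact n / a ^ n) * min 1 s)"
    using integrable_min by (rule integrable_mult_right)
  show "AE s in \<nu>. norm (s ^ n * exp (- (a * s))) \<le> norm ((1 + fact n / a ^ n) * min 1 s)"
    using AE_pos
  proof eventually_elim
    case (elim s)
    show ?case
    proof (cases "s \<le> 1")
      case True
      have "s ^ n * exp (- (a * s)) \<le> s ^ 1 * 1"
        using True elim assms by (intro mult_mono power_decreasing) auto
      also have "\<dots> \<le> (1 + fact n / a ^ n) * s" using elim assms by (simp add: distrib_right)
      finally show ?thesis using True elim assms by (simp add: abs_mult)
    next
      case False
      then show ?thesis
        using power_times_exp_le[of a s n] assms elim by (simp add: abs_mult)
    qed
  qed
qed simp

lemma norm_one_minus_exp_le:
  fixes z :: complex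
  assumes "Re z \<ge> 0" "s > 0"
  shows "norm (1 - exp (- (z * of_real s))) \<le> (2 + norm z) * min 1 s"
proof (cases "s \<le> 1")
  case True
  have "norm (exp (- (z * of_real s)) - exp 0) \<le> 1 * norm (- (z * of_real s) - 0)"
    by (rule field_differentiable_bound[of "{z. Re z \<le> 0}" exp exp])
      (use assms in \<open>auto intro!: derivative_eq_intros convex_halfspace_Re_le\<close>)
  also have "\<dots> = norm z * s" using assms by (simp add: norm_mult)
  also have "\<dots> \<le> (2 + norm z) * s" using assms by (simp add: distrib_right)
  finally show ?thesis using True by (simp add: norm_minus_commute)
next
  case False
  have "norm (1 - exp (- (z * of_real s))) \<le> norm (1::complex) + norm (exp (- (z * of_real s)))"
    by (rule norm_triangle_ineq4)
  also have "\<dots> \<le> 1 + 1" using assms by simp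
  also have "\<dots> \<le> 2 + norm z" by simp
  finally show ?thesis using False by (simp add: min_absorb1)
qed

lemma integrable_one_minus_exp:
  assumes "Re z \<ge> 0"
  shows "integrable \<nu> (\<lambda>s. 1 - exp (- (z * of_real s)))"
proof (rule Bochner_Integration.integrable_bound)
  show "integrable \<nu> (\<lambda>s. (2 + norm z) * min 1 s)"
    using integrable_min by (rule integrable_mult_right)
  show "AE s in \<nu>. norm (1 - exp (- (z * of_real s))) \<le> norm ((2 + norm z) * min 1 s)"
    using AE_pos by eventually_elim (use norm_one_minus_exp_le[OF assms] in fastforce)
qed simp

text \<open>The Laplace exponent without drift, extended to the closed right half-plane.\<close>

definition exponent :: "complex \<Rightarrow> complex" where
  "exponent z = (LINT s|\<nu>. 1 - exp (- (z * of_real s)))"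

text \<open>The \<open>n\<close>-th moment of \<open>\<nu>\<close> tilted by \<open>exp (- l s)\<close>. For \<open>l > 0\<close> and without
  drift, the first moment is \<open>\<phi>'\<close> and the second is \<open>- \<phi>''\<close>.\<close>

definition moment :: "nat \<Rightarrow> real \<Rightarrow> real" where
  "moment n l = (LINT s|\<nu>. s ^ n * exp (- (l * s)))"

lemma exponent_of_real: "l \<ge> 0 \<Longrightarrow> exponent (of_real l) = of_real (LINT s|\<nu>. 1 - exp (- (l * s)))"
  unfolding exponent_def by (simp flip: integral_complex_of_real exp_of_real)

lemma exponent_has_field_derivative:
  assumes "Re z > 0"
  shows "(exponent has_field_derivative (LINT s|\<nu>. of_real s * exp (- (z * of_real s)))) (at z)"
  unfolding exponent_def
proof (rule has_field_derivative_integral[where r = "Re z / 2" and B = "\<lambda>s. s ^ 1 * exp (- (Re z / 2 * s))"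
      and F' = "\<lambda>z s. of_real s * exp (- (z * of_real s))"])
  have *: "Re y \<ge> Re z / 2" if "y \<in> ball z (Re z / 2)" for y
    using that abs_Re_le_cmod[of "z - y"] by (auto simp: dist_norm abs_if split: if_splits)
  show "integrable \<nu> (\<lambda>s. 1 - exp (- (y * of_real s)))" if "y \<in> ball z (Re z / 2)" for y
    using *[OF that] assms by (intro integrable_one_minus_exp) auto
  show "AE s in \<nu>. \<forall>y\<in>ball z (Re z / 2). ((\<lambda>y. 1 - exp (- (y * of_real s))) has_field_derivative
      of_real s * exp (- (y * of_real s))) (at y) \<and> norm (of_real s * exp (- (y * of_real s))) \<le> s ^ 1 * exp (- (Re z / 2 * s))"
    using AE_pos
  proof eventually_elim
    case (elim s)
    show ?case
    proof (intro ballI conjI)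
      fix y assume y: "y \<in> ball z (Re z / 2)"
      show "((\<lambda>y. 1 - exp (- (y * of_real s))) has_field_derivative of_real s * exp (- (y * of_real s))) (at y)"
        by (auto intro!: derivative_eq_intros)
      have "exp (- (Re y * s)) \<le> exp (- (Re z / 2 * s))" 
        using *[OF y] elim by (auto intro!: mult_right_mono simp del: times_divide_eq_left)
      then show "norm (of_real s * exp (- (y * of_real s))) \<le> s ^ 1 * exp (- (Re z / 2 * s))"
        using elim by (simp add: norm_mult)
    qed
  qed
qed (use assms integrable_moment[of 1 "Re z / 2"] in auto)

lemma exponent_holomorphic: "exponent holomorphic_on {z. Re z > 0}"
  by (rule holomorphic_onI)
    (use exponent_has_field_derivative in \<open>auto simp: field_differentiable_def intro: has_field_derivative_at_within\<close>)

lemma moment_nonneg: "moment n l \<ge> 0" 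
  unfolding moment_def by (rule integral_nonneg_AE) (use AE_pos in \<open>auto elim!: eventually_mono\<close>)

lemma real_exponent_has_derivative:
  assumes "l > 0"
  shows "((\<lambda>l. LINT s|\<nu>. 1 - exp (- (l * s))) has_real_derivative moment 1 l) (at l)"
  unfolding moment_def
proof (rule has_field_derivative_integral[where r = "l / 2" and B = "\<lambda>s. s ^ 1 * exp (- (l / 2 * s))"
      and F' = "\<lambda>l s. s ^ 1 * exp (- (l * s))"])
  have *: "y \<ge> l / 2" if "y \<in> ball l (l / 2)" for y
    using that by (auto simp: dist_real_def abs_if split: if_splits)
  show "integrable \<nu> (\<lambda>s. 1 - exp (- (y * s)))" if "y \<in> ball l (l / 2)" for y
    using integrable_Re[OF integrable_one_minus_exp[of "of_real y"]] *[OF that] assms by (simp add: Re_exp)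
  show "AE s in \<nu>. \<forall>y\<in>ball l (l / 2). ((\<lambda>y. 1 - exp (- (y * s))) has_real_derivative
      s ^ 1 * exp (- (y * s))) (at y) \<and> norm (s ^ 1 * exp (- (y * s))) \<le> s ^ 1 * exp (- (l / 2 * s))"
    using AE_pos
  proof eventually_elim
    case (elim s)
    show ?case
    proof (intro ballI conjI)
      fix y assume y: "y \<in> ball l (l / 2)"
      show "((\<lambda>y. 1 - exp (- (y * s))) has_real_derivative s ^ 1 * exp (- (y * s))) (at y)"
        by (auto intro!: derivative_eq_intros)
      have "exp (- (y * s)) \<le> exp (- (l / 2 * s))"
        using *[OF y] elim by (auto intro!: mult_right_mono simp del: times_divide_eq_left)
      then show "norm (s ^ 1 * exp (- (y * s))) \<le> s ^ 1 * exp (- (l / 2 * s))"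
        using elim by (simp add: abs_mult)
    qed
  qed
qed (use assms integrable_moment[of 1 "l / 2"] in auto)

lemma moment_has_derivative:
  assumes "l > 0" "n \<ge> 1"
  shows "(moment n has_real_derivative - moment (Suc n) l) (at l)"
proof -
  have "(moment n has_real_derivative (LINT s|\<nu>. - (s ^ Suc n * exp (- (l * s))))) (at l)"
    unfolding moment_def
  proof (rule has_field_derivative_integral[where r = "l / 2" and B = "\<lambda>s. s ^ Suc n * exp (- (l / 2 * s))"
        and F' = "\<lambda>l s. - (s ^ Suc n * exp (- (l * s)))"])
    have *: "y \<ge> l / 2" if "y \<in> ball l (l / 2)" for y
      using that by (auto simp: dist_real_def abs_if split: if_splits)
    show "integrable \<nu> (\<lambda>s. s ^ n * exp (- (y * s)))" if "y \<in> ball l (l / 2)" for y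
      using *[OF that] assms by (intro integrable_moment) auto
    show "AE s in \<nu>. \<forall>y\<in>ball l (l / 2). ((\<lambda>y. s ^ n * exp (- (y * s))) has_real_derivative
        - (s ^ Suc n * exp (- (y * s)))) (at y) \<and> norm (- (s ^ Suc n * exp (- (y * s)))) \<le> s ^ Suc n * exp (- (l / 2 * s))"
      using AE_pos
    proof eventually_elim
      case (elim s)
      show ?case
      proof (intro ballI conjI)
        fix y assume y: "y \<in> ball l (l / 2)"
        show "((\<lambda>y. s ^ n * exp (- (y * s))) has_real_derivative - (s ^ Suc n * exp (- (y * s)))) (at y)"
          by (auto intro!: derivative_eq_intros)
        have "exp (- (y * s)) \<le> exp (- (l / 2 * s))"
          using *[OF y] elim by (auto intro!: mult_right_mono simp del: times_divide_eq_left)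
        then show "norm (- (s ^ Suc n * exp (- (y * s)))) \<le> s ^ Suc n * exp (- (l / 2 * s))"
          using elim by (simp add: abs_mult)
      qed
    qed
    show "integrable \<nu> (\<lambda>s. s ^ Suc n * exp (- (l / 2 * s)))"
      using assms by (intro integrable_moment) auto
  qed (use assms in auto)
  then show ?thesis by (simp add: moment_def)
qed

lemma moment_1_tendsto_0: "(moment 1 \<longlongrightarrow> 0) at_top"
proof -
  have "((\<lambda>l. LINT s|\<nu>. s ^ 1 * exp (- (l * s))) \<longlongrightarrow> (LINT s|\<nu>. 0)) at_top"
  proof (rule integral_dominated_convergence_at_top[where w = "\<lambda>s. s ^ 1 * exp (- (1 * s))"])
    show "AE s in \<nu>. ((\<lambda>l. s ^ 1 * exp (- (l * s))) \<longlongrightarrow> 0) at_top"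
      using AE_pos by eventually_elim real_asymp
    show "\<forall>\<^sub>F l in at_top. AE s in \<nu>. norm (s ^ 1 * exp (- (l * s))) \<le> s ^ 1 * exp (- (1 * s))"
      using eventually_ge_at_top[of "1::real"]
    proof eventually_elim
      case (elim l)
      show ?case using AE_pos by eventually_elim (use elim in \<open>auto simp: abs_mult\<close>)
    qed
  qed (use integrable_moment[of 1 1] in auto)
  then show ?thesis by (simp add: moment_def[abs_def])
qed

text \<open>One positive moment excludes \<open>\<nu> = 0\<close>, and then all convergent moments are positive.\<close>

lemma moment_pos_transfer:
  assumes "moment n l > 0" "m \<ge> 1" "r > 0"
  shows "moment m r > 0"
proof (rule ccontr)
  assume "\<not> ?thesis"
  then have "moment m r = 0" using moment_nonneg[of m r] by simp
  then have "AE s in \<nu>. s ^ m * exp (- (r * s)) = 0"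
    unfolding moment_def
    by (subst (asm) integral_nonneg_eq_0_iff_AE)
      (use AE_pos integrable_moment[OF assms(2,3)] in \<open>auto elim!: eventually_mono\<close>)
  then have "AE s in \<nu>. False"
    using AE_pos by eventually_elim auto
  then have "moment n l = (LINT s|\<nu>. 0)"
    unfolding moment_def by (intro integral_cong_AE) auto
  then show False using assms(1) by simp
qed

end

section \<open>Consequences of weak lower scaling\<close>

lemma one_minus_cos_ge:
  fixes y :: real
  assumes "\<bar>y\<bar> \<le> 1"
  shows "y ^ 2 / 4 \<le> 1 - cos y"
proof -
  have "\<bar>Re (iexp y - (\<Sum>k\<le>3. (\<i> * y) ^ k / fact k))\<bar> \<le> \<bar>y\<bar> ^ Suc 3 / fact (Suc 3)"
    by (rule order_trans[OF abs_Re_le_cmod iexp_approx1])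
  moreover have "Re (iexp y - (\<Sum>k\<le>3. (\<i> * y) ^ k / fact k)) = cos y - (1 - y ^ 2 / 2)"
    by (simp add: eval_nat_numeral Re_exp power2_eq_square)
  moreover have "\<bar>y\<bar> ^ Suc 3 / fact (Suc 3) \<le> y ^ 2 / 24"
  proof -
    have "\<bar>y\<bar> ^ Suc 3 \<le> \<bar>y\<bar> ^ 2" using assms by (intro power_decreasing) auto
    then show ?thesis by (simp add: fact_numeral)
  qed
  ultimately show ?thesis using zero_le_power2[of y] by linarith
qed

text \<open>The weak lower scaling condition for \<open>moment 2\<close>, that is for \<open>- \<phi>''\<close>. The condition gets weaker
  as \<open>\<alpha>\<close> decreases, so \<open>\<alpha> \<le> 1\<close> is no loss of generality; the estimates below use \<open>\<alpha> \<le> 2\<close>.\<close>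

locale wlsc_levy_measure = levy_measure_space +
  fixes c x0 \<alpha> :: real
  assumes c_pos: "c > 0" and x0_nonneg: "x0 \<ge> 0" and alpha: "0 < \<alpha>" "\<alpha> \<le> 1"
    and moment_2_pos: "\<And>l. l > 0 \<Longrightarrow> moment 2 l > 0"
    and scaling: "\<And>l y. l \<ge> 1 \<Longrightarrow> y > x0 \<Longrightarrow> c * l powr (\<alpha> - 2) * moment 2 y \<le> moment 2 (l * y)"
begin

lemma integrable_truncated_moment:
  assumes "w > 0"
  shows "integrable \<nu> (\<lambda>s. indicator {..1 / w} s * s ^ 2)"
proof (rule Bochner_Integration.integrable_bound)
  show "integrable \<nu> (\<lambda>s. exp 1 * (s ^ 2 * exp (- (w * s))))"
    using assms by (intro integrable_mult_right integrable_moment) auto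
  show "AE s in \<nu>. norm (indicator {..1 / w} s * s ^ 2) \<le> norm (exp 1 * (s ^ 2 * exp (- (w * s))))"
  proof (rule AE_I2)
    fix s :: real
    have "1 * s ^ 2 \<le> exp (1 - w * s) * s ^ 2" if "s \<le> 1 / w"
      using that assms by (intro mult_right_mono) (auto simp: field_simps)
    then show "norm (indicator {..1 / w} s * s ^ 2) \<le> norm (exp 1 * (s ^ 2 * exp (- (w * s))))"
      by (auto simp: indicator_def exp_diff exp_minus field_simps abs_mult)
  qed
qed simp

text \<open>The jumps of size at most \<open>1 / w\<close> carry a fixed fraction of the tilted second moment. Splitting
  \<open>moment 2 (L w)\<close> at \<open>s = 1 / w\<close> bounds it by the truncated moment plus
  \<open>exp (- (L - 1)) * moment 2 w\<close>, whereas scaling bounds it from below by a power of \<open>L\<close> times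
  \<open>moment 2 w\<close>; for large \<open>L\<close> the exponentially small term is absorbed. No upper scaling is needed.\<close>

lemma truncated_moment_ge:
  obtains K where "K > 0"
    "\<And>w. w > x0 \<Longrightarrow> K * moment 2 w \<le> (LINT s|\<nu>. indicator {..1 / w} s * s ^ 2)"
proof -
  have "((\<lambda>L. exp (- (L - 1)) * L powr (2 - \<alpha>)) \<longlongrightarrow> 0) at_top"
    by real_asymp
  then have "\<forall>\<^sub>F L in at_top. exp (- (L - 1)) * L powr (2 - \<alpha>) < c / 2"
    using c_pos by (intro order_tendstoD) auto
  then have "\<forall>\<^sub>F L in at_top. L \<ge> 1 \<and> exp (- (L - 1)) * L powr (2 - \<alpha>) < c / 2"
    using eventually_ge_at_top[of "1::real"] by eventually_elim auto
  then obtain L where L: "L \<ge> 1" "exp (- (L - 1)) * L powr (2 - \<alpha>) < c / 2"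
    using eventually_happens'[OF trivial_limit_at_top_linorder] by blast
  define K where "K = c * L powr (\<alpha> - 2) / 2"
  have LK: "exp (- (L - 1)) \<le> K"
    using L by (simp add: K_def powr_diff field_simps)
  show ?thesis
  proof
    show "K > 0" using c_pos L by (simp add: K_def)
    fix w assume w: "w > x0"
    then have w0: "w > 0" using x0_nonneg by simp
    have "2 * K * moment 2 w \<le> moment 2 (L * w)"
      using scaling[OF L(1) w] by (simp add: K_def)
    also have "\<dots> \<le> (LINT s|\<nu>. indicator {..1 / w} s * s ^ 2 + exp (- (L - 1)) * (s ^ 2 * exp (- (w * s))))"
      unfolding moment_def
    proof (rule integral_mono_AE)
      show "AE s in \<nu>. s ^ 2 * exp (- (L * w * s)) \<le> indicator {..1 / w} s * s ^ 2 + exp (- (L - 1)) * (s ^ 2 * exp (- (w * s)))"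
        using AE_pos
      proof eventually_elim
        case (elim s)
        show ?case
        proof (cases "s \<le> 1 / w")
          case True
          have "s ^ 2 * exp (- (L * w * s)) \<le> s ^ 2 * 1"
            using elim w0 L by (intro mult_left_mono) auto
          then show ?thesis using True by (simp add: add_increasing2)
        next
          case False
          then have "w * s \<ge> 1" using w0 by (simp add: field_simps)
          then have "(L - 1) * 1 \<le> (L - 1) * (w * s)" using L by (intro mult_left_mono) auto
          then have "exp (- (L * w * s)) \<le> exp (- (L - 1) + - (w * s))"
            by (simp add: algebra_simps)
          then have "s ^ 2 * exp (- (L * w * s)) \<le> s ^ 2 * (exp (- (L - 1)) * exp (- (w * s)))"
            unfolding exp_add by (rule mult_left_mono) simp
          then show ?thesis using False by (simp add: mult.left_commute[of "s ^ 2"])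
        qed
      qed
    qed (use w0 L in \<open>auto intro!: Bochner_Integration.integrable_add integrable_mult_right integrable_moment integrable_truncated_moment\<close>)
    also have "\<dots> = (LINT s|\<nu>. indicator {..1 / w} s * s ^ 2) + exp (- (L - 1)) * moment 2 w"
      unfolding moment_def using w0
      by (subst Bochner_Integration.integral_add) (auto intro!: integrable_mult_right integrable_moment integrable_truncated_moment)
    also have "\<dots> \<le> (LINT s|\<nu>. indicator {..1 / w} s * s ^ 2) + K * moment 2 w"
      using LK moment_nonneg by (intro add_left_mono mult_right_mono) auto
    finally show "K * moment 2 w \<le> (LINT s|\<nu>. indicator {..1 / w} s * s ^ 2)" by simp
  qed
qed

lemma integrable_tilted_iexp:
  assumes "w > 0"
  shows "complex_integrable \<nu> (\<lambda>s. exp (- (w * s)) *\<^sub>R (iexp (\<theta> * s) - 1))"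
proof (rule Bochner_Integration.integrable_bound)
  show "integrable \<nu> (\<lambda>s. \<bar>\<theta>\<bar> * (s ^ 1 * exp (- (w * s))))"
    using assms by (intro integrable_mult_right integrable_moment) auto
  show "AE s in \<nu>. norm (exp (- (w * s)) *\<^sub>R (iexp (\<theta> * s) - 1)) \<le> norm (\<bar>\<theta>\<bar> * (s ^ 1 * exp (- (w * s))))"
    using AE_pos
  proof eventually_elim
    case (elim s)
    have "norm (iexp (\<theta> * s) - 1) \<le> \<bar>\<theta> * s\<bar>"
      using iexp_approx1[of "\<theta> * s" 0] by simp
    then have "exp (- (w * s)) * norm (iexp (\<theta> * s) - 1) \<le> exp (- (w * s)) * \<bar>\<theta> * s\<bar>"
      by (rule mult_left_mono) simp
    then show ?case using elim by (simp add: abs_mult mult_ac)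
  qed
qed simp

lemma integrable_tilted_cos:
  assumes "w > 0"
  shows "integrable \<nu> (\<lambda>s. exp (- (w * s)) * (1 - cos (\<theta> * s)))"
  using integrable_Re[OF integrable_tilted_iexp[OF assms, of \<theta>], THEN Bochner_Integration.integrable_minus]
  by (simp add: Re_exp algebra_simps)

lemma integral_tilted_cos_ge:
  assumes "w > 0" "w \<le> \<eta>" "\<bar>\<theta>\<bar> \<le> \<eta>"
  shows "\<theta> ^ 2 / (4 * exp 1) * (LINT s|\<nu>. indicator {..1 / \<eta>} s * s ^ 2) \<le> (LINT s|\<nu>. exp (- (w * s)) * (1 - cos (\<theta> * s)))"
proof -
  have \<eta>: "\<eta> > 0" using assms by simp
  have "(LINT s|\<nu>. \<theta> ^ 2 / (4 * exp 1) * (indicator {..1 / \<eta>} s * s ^ 2)) \<le> (LINT s|\<nu>. exp (- (w * s)) * (1 - cos (\<theta> * s)))"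
  proof (rule integral_mono_AE)
    show "AE s in \<nu>. \<theta> ^ 2 / (4 * exp 1) * (indicator {..1 / \<eta>} s * s ^ 2) \<le> exp (- (w * s)) * (1 - cos (\<theta> * s))"
      using AE_pos
    proof eventually_elim
      case (elim s)
      show ?case
      proof (cases "s \<le> 1 / \<eta>")
        case True
        then have "\<eta> * s \<le> 1" using \<eta> by (simp add: field_simps)
        have 1: "w * s \<le> 1" and 2: "\<bar>\<theta> * s\<bar> \<le> 1"
          using order_trans[OF mult_right_mono[of w \<eta> s] \<open>\<eta> * s \<le> 1\<close>]
            order_trans[OF mult_right_mono[of "\<bar>\<theta>\<bar>" \<eta> s] \<open>\<eta> * s \<le> 1\<close>] assms elim
          by (auto simp: abs_mult)
        have "exp (- 1) * ((\<theta> * s) ^ 2 / 4) \<le> exp (- (w * s)) * (1 - cos (\<theta> * s))"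
          using 1 one_minus_cos_ge[OF 2] by (intro mult_mono) auto
        then show ?thesis using True by (simp add: exp_minus field_simps power_mult_distrib)
      qed (simp add: mult_nonneg_nonneg)
    qed
  qed (use assms \<eta> in \<open>auto intro!: integrable_tilted_cos integrable_mult_right integrable_truncated_moment\<close>)
  then show ?thesis by simp
qed

text \<open>Lower bounds for minus the real part of the tilted exponent at frequency \<open>\<theta>\<close>: quadratic for
  \<open>\<bar>\<theta>\<bar> \<le> w\<close>, and growing like \<open>\<bar>\<theta>\<bar> powr \<alpha>\<close> beyond. In the second range the truncation is at
  \<open>1 / \<bar>\<theta>\<bar>\<close>, and scaling compares \<open>moment 2 \<bar>\<theta>\<bar>\<close> with \<open>moment 2 w\<close>.\<close>

lemma tilted_cos_lower_bound:
  obtains \<kappa> where "\<kappa> > 0"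
    "\<And>w \<theta>. w > x0 \<Longrightarrow> \<bar>\<theta>\<bar> \<le> w \<Longrightarrow> \<kappa> * \<theta> ^ 2 * moment 2 w \<le> (LINT s|\<nu>. exp (- (w * s)) * (1 - cos (\<theta> * s)))"
    "\<And>w \<theta>. w > x0 \<Longrightarrow> w \<le> \<bar>\<theta>\<bar> \<Longrightarrow>
      \<kappa> * \<theta> ^ 2 * (c * (\<bar>\<theta>\<bar> / w) powr (\<alpha> - 2) * moment 2 w) \<le> (LINT s|\<nu>. exp (- (w * s)) * (1 - cos (\<theta> * s)))"
proof -
  obtain K where K: "K > 0" 
    "\<And>w. w > x0 \<Longrightarrow> K * moment 2 w \<le> (LINT s|\<nu>. indicator {..1 / w} s * s ^ 2)"
    by (rule truncated_moment_ge) blast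
  define \<kappa> where "\<kappa> = K / (4 * exp 1)"
  have *: "\<kappa> * \<theta> ^ 2 * moment 2 \<eta> \<le> (LINT s|\<nu>. exp (- (w * s)) * (1 - cos (\<theta> * s)))"
    if "w > x0" "w \<le> \<eta>" "\<bar>\<theta>\<bar> \<le> \<eta>" for w \<eta> \<theta>
  proof -
    have "\<kappa> * \<theta> ^ 2 * moment 2 \<eta> = \<theta> ^ 2 / (4 * exp 1) * (K * moment 2 \<eta>)"
      by (simp add: \<kappa>_def)
    also have "\<dots> \<le> \<theta> ^ 2 / (4 * exp 1) * (LINT s|\<nu>. indicator {..1 / \<eta>} s * s ^ 2)"
      using that K(2)[of \<eta>] by (intro mult_left_mono) auto
    also have "\<dots> \<le> (LINT s|\<nu>. exp (- (w * s)) * (1 - cos (\<theta> * s)))"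
      using that x0_nonneg by (intro integral_tilted_cos_ge) auto
    finally show ?thesis .
  qed
  show ?thesis
  proof
    show "\<kappa> > 0" using K by (simp add: \<kappa>_def)
    then have \<kappa>: "\<kappa> \<ge> 0" by simp
    show "\<kappa> * \<theta> ^ 2 * moment 2 w \<le> (LINT s|\<nu>. exp (- (w * s)) * (1 - cos (\<theta> * s)))"
      if "w > x0" "\<bar>\<theta>\<bar> \<le> w" for w \<theta>
      using that by (intro *) auto
    show "\<kappa> * \<theta> ^ 2 * (c * (\<bar>\<theta>\<bar> / w) powr (\<alpha> - 2) * moment 2 w) \<le> (LINT s|\<nu>. exp (- (w * s)) * (1 - cos (\<theta> * s)))"
      if w: "w > x0" "w \<le> \<bar>\<theta>\<bar>" for w \<theta>
    proof -
      have "c * (\<bar>\<theta>\<bar> / w) powr (\<alpha> - 2) * moment 2 w \<le> moment 2 (\<bar>\<theta>\<bar> / w * w)"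
        using w x0_nonneg by (intro scaling) auto
      then have "\<kappa> * \<theta> ^ 2 * (c * (\<bar>\<theta>\<bar> / w) powr (\<alpha> - 2) * moment 2 w) \<le> \<kappa> * \<theta> ^ 2 * moment 2 \<bar>\<theta>\<bar>"
        using w x0_nonneg \<kappa> by (intro mult_left_mono) auto
      also have "\<dots> \<le> (LINT s|\<nu>. exp (- (w * s)) * (1 - cos (\<theta> * s)))"
        using w by (intro *) auto
      finally show ?thesis .
    qed
  qed
qed

text \<open>One factor \<open>s\<close> costs \<open>2 / w\<close> and half of the exponential; scaling from \<open>w / 2\<close> to \<open>w\<close> restores it.\<close>

lemma moment_3_le:
  assumes "w > 2 * x0" "w > 0"
  shows "moment 3 w \<le> 2 / (c * 2 powr (\<alpha> - 2)) * (moment 2 w / w)"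
proof -
  have "moment 3 w \<le> (LINT s|\<nu>. 2 / w * (s ^ 2 * exp (- (w / 2 * s))))"
    unfolding moment_def
  proof (rule integral_mono_AE)
    show "AE s in \<nu>. s ^ 3 * exp (- (w * s)) \<le> 2 / w * (s ^ 2 * exp (- (w / 2 * s)))"
      using AE_pos
    proof eventually_elim
      case (elim s)
      have "s ^ 1 * exp (- (w / 2 * s)) \<le> fact 1 / (w / 2) ^ 1"
        using elim assms by (intro power_times_exp_le) auto
      then have "(s ^ 2 * exp (- (w / 2 * s))) * (s * exp (- (w / 2 * s))) \<le> (s ^ 2 * exp (- (w / 2 * s))) * (2 / w)"
        by (intro mult_left_mono) auto
      moreover have "exp (- (w * s)) = exp (- (w / 2 * s)) * exp (- (w / 2 * s))"
        by (simp flip: exp_add)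
      ultimately show ?case by (simp add: power3_eq_cube power2_eq_square mult_ac)
    qed
    show "integrable \<nu> (\<lambda>s. 2 / w * (s ^ 2 * exp (- (w / 2 * s))))"
      using assms by (intro integrable_mult_right integrable_moment) auto
  qed (use assms in \<open>auto intro!: integrable_moment\<close>)
  also have "\<dots> = 2 / w * moment 2 (w / 2)"
    by (simp add: moment_def)
  also have "moment 2 (w / 2) \<le> moment 2 w / (c * 2 powr (\<alpha> - 2))"
    using scaling[of 2 "w / 2"] c_pos assms by (simp add: field_simps)
  finally show ?thesis using assms by (simp add: mult_left_mono field_simps)
qed

lemma moment_2_lower_bound:
  obtains C where "C > 0" "\<And>w. w \<ge> x0 + 1 \<Longrightarrow> C * w powr \<alpha> \<le> w ^ 2 * moment 2 w"
proof
  define y where "y = x0 + 1"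
  have y: "y > x0" "y > 0" using x0_nonneg by (auto simp: y_def)
  show "c * y powr (2 - \<alpha>) * moment 2 y > 0" using c_pos y moment_2_pos by simp
  fix w assume w: "w \<ge> x0 + 1"
  then have wy: "w \<ge> y" "w > 0" using y by (auto simp: y_def)
  have "c * (w / y) powr (\<alpha> - 2) * moment 2 y \<le> moment 2 (w / y * y)"
    using wy y by (intro scaling) auto
  then have "w ^ 2 * (c * (w / y) powr (\<alpha> - 2) * moment 2 y) \<le> w ^ 2 * moment 2 w"
    using y by (intro mult_left_mono) auto
  also have "w ^ 2 * (c * (w / y) powr (\<alpha> - 2) * moment 2 y) = c * y powr (2 - \<alpha>) * moment 2 y * w powr \<alpha>"
    using wy y by (simp add: powr_divide powr_diff field_simps powr_realpow)
  finally show "c * y powr (2 - \<alpha>) * moment 2 y * w powr \<alpha> \<le> w ^ 2 * moment 2 w" .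
qed

text \<open>The cumulant generating function of the tilted measure, compensated by its mean and taken per unit of time: if \<open>N\<close> is the law
  of \<open>T t\<close> tilted by \<open>exp (- w s)\<close>, then \<open>exp (t * cgf w \<theta>)\<close> is the characteristic function of \<open>N\<close>
  recentred at its mean \<open>t * moment 1 w\<close>.\<close>

definition cgf :: "real \<Rightarrow> real \<Rightarrow> complex" where
  "cgf w \<theta> = (LINT s|\<nu>. exp (- (w * s)) *\<^sub>R (iexp (\<theta> * s) - 1 - \<i> * of_real (\<theta> * s)))"

lemma integrable_tilted_linear:
  assumes "w > 0"
  shows "complex_integrable \<nu> (\<lambda>s. exp (- (w * s)) *\<^sub>R (\<i> * of_real (\<theta> * s)))"
    "(LINT s|\<nu>. exp (- (w * s)) *\<^sub>R (\<i> * of_real (\<theta> * s))) = \<i> * of_real (\<theta> * moment 1 w)"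
proof -
  have eq: "exp (- (w * s)) *\<^sub>R (\<i> * of_real (\<theta> * s)) = \<i> * (of_real \<theta> * of_real (s ^ 1 * exp (- (w * s))))" for s
    by (simp add: scaleR_conv_of_real mult_ac del: of_real_exp flip: exp_of_real)
  have int: "complex_integrable \<nu> (\<lambda>s. of_real (s ^ 1 * exp (- (w * s))))"
    using assms by (intro integrable_of_real integrable_moment) auto
  then show "complex_integrable \<nu> (\<lambda>s. exp (- (w * s)) *\<^sub>R (\<i> * of_real (\<theta> * s)))"
    unfolding eq by (intro integrable_mult_right)
  show "(LINT s|\<nu>. exp (- (w * s)) *\<^sub>R (\<i> * of_real (\<theta> * s))) = \<i> * of_real (\<theta> * moment 1 w)"
    unfolding eq integral_mult_right_zero moment_def integral_complex_of_real by simp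
qed

lemma cgf_eq_exponent:
  assumes "w > 0"
  shows "cgf w \<theta> = exponent (of_real w) - exponent (of_real w - \<i> * of_real \<theta>) - \<i> * of_real (\<theta> * moment 1 w)"
proof -
  have "cgf w \<theta> = (LINT s|\<nu>. exp (- (w * s)) *\<^sub>R (iexp (\<theta> * s) - 1) - exp (- (w * s)) *\<^sub>R (\<i> * of_real (\<theta> * s)))"
    unfolding cgf_def scaleR_diff_right ..
  also have "\<dots> = (LINT s|\<nu>. exp (- (w * s)) *\<^sub>R (iexp (\<theta> * s) - 1)) - \<i> * of_real (\<theta> * moment 1 w)"
    using integrable_tilted_linear[OF assms, of \<theta>] integrable_tilted_iexp[OF assms, of \<theta>]
    by (subst Bochner_Integration.integral_diff) auto
  also have "(\<lambda>s. exp (- (w * s)) *\<^sub>R (iexp (\<theta> * s) - 1)) =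
     (\<lambda>s. (1 - exp (- (of_real w * of_real s))) - (1 - exp (- ((of_real w - \<i> * of_real \<theta>) * of_real s))))"
  proof
    fix s
    have "- ((of_real w - \<i> * of_real \<theta>) * of_real s) = - (of_real w * of_real s) + \<i> * of_real (\<theta> * s)"
      by (simp add: algebra_simps)
    then have "exp (- ((of_real w - \<i> * of_real \<theta>) * of_real s)) = exp (- (of_real w * of_real s)) * iexp (\<theta> * s)"
      by (simp only: exp_add)
    moreover have "complex_of_real (exp (- (w * s))) = exp (- (of_real w * of_real s))"
      by (simp add: exp_of_real[symmetric])
    ultimately show "exp (- (w * s)) *\<^sub>R (iexp (\<theta> * s) - 1) =
       (1 - exp (- (of_real w * of_real s))) - (1 - exp (- ((of_real w - \<i> * of_real \<theta>) * of_real s)))"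
      by (simp only: scaleR_conv_of_real) (simp add: algebra_simps)
  qed
  also have "(LINT s|\<nu>. \<dots> s) = exponent (of_real w) - exponent (of_real w - \<i> * of_real \<theta>)"
    unfolding exponent_def using assms
    by (subst Bochner_Integration.integral_diff) (auto intro!: integrable_one_minus_exp)
  finally show ?thesis .
qed

lemma integrable_cgf:
  assumes "w > 0"
  shows "complex_integrable \<nu> (\<lambda>s. exp (- (w * s)) *\<^sub>R (iexp (\<theta> * s) - 1 - \<i> * of_real (\<theta> * s)))"
  using Bochner_Integration.integrable_diff[OF integrable_tilted_iexp[OF assms] integrable_tilted_linear(1)[OF assms]]
  by (simp only: scaleR_diff_right)

lemma continuous_cgf:
  assumes "w > 0"
  shows "continuous_on UNIV (cgf w)"
proof -
  have "continuous_on UNIV (\<lambda>\<theta>. exponent (of_real w - \<i> * of_real \<theta>))"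
    by (rule continuous_on_compose2[OF holomorphic_on_imp_continuous_on[OF exponent_holomorphic]])
      (use assms in \<open>auto intro!: continuous_intros\<close>)
  then show ?thesis
    unfolding cgf_eq_exponent[OF assms, abs_def] by (intro continuous_intros)
qed

lemma Re_cgf:
  assumes "w > 0"
  shows "Re (cgf w \<theta>) = - (LINT s|\<nu>. exp (- (w * s)) * (1 - cos (\<theta> * s)))"
proof -
  have "Re (exp (- (w * s)) *\<^sub>R (iexp (\<theta> * s) - 1 - \<i> * of_real (\<theta> * s))) = - (exp (- (w * s)) * (1 - cos (\<theta> * s)))" for s
    by (simp add: Re_exp right_diff_distrib)
  with integral_Re[OF integrable_cgf[OF assms, of \<theta>]]
  have "Re (cgf w \<theta>) = (LINT s|\<nu>. - (exp (- (w * s)) * (1 - cos (\<theta> * s))))"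
    by (simp only: cgf_def)
  then show ?thesis by simp
qed

lemma cgf_approx:
  assumes "w > 0"
  shows "norm (cgf w \<theta> + of_real (\<theta> ^ 2 * moment 2 w / 2)) \<le> \<bar>\<theta>\<bar> ^ 3 / 6 * moment 3 w"
proof -
  define remainder where "remainder = (\<lambda>s. exp (- (w * s)) *\<^sub>R (iexp (\<theta> * s) - 1 - \<i> * of_real (\<theta> * s))
    + complex_of_real (\<theta> ^ 2 / 2 * (s ^ 2 * exp (- (w * s)))))"
  note int1 = integrable_cgf[OF assms, of \<theta>]
  have int2: "complex_integrable \<nu> (\<lambda>s. of_real (\<theta> ^ 2 / 2 * (s ^ 2 * exp (- (w * s)))))"
    using assms by (intro integrable_of_real integrable_mult_right integrable_moment) auto
  have "of_real (\<theta> ^ 2 * moment 2 w / 2) = (CLINT s|\<nu>. of_real (\<theta> ^ 2 / 2 * (s ^ 2 * exp (- (w * s)))))"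
    unfolding integral_complex_of_real integral_mult_right_zero moment_def by simp
  then have eq: "cgf w \<theta> + of_real (\<theta> ^ 2 * moment 2 w / 2) = (CLINT s|\<nu>. remainder s)"
    unfolding cgf_def remainder_def by (subst Bochner_Integration.integral_add[OF int1 int2]) simp
  have int: "complex_integrable \<nu> remainder"
    unfolding remainder_def by (rule Bochner_Integration.integrable_add[OF int1 int2])
  have "norm (CLINT s|\<nu>. remainder s) \<le> (LINT s|\<nu>. norm (remainder s))"
    by (rule integral_norm_bound)
  also have "\<dots> \<le> (LINT s|\<nu>. \<bar>\<theta>\<bar> ^ 3 / 6 * (s ^ 3 * exp (- (w * s))))"
  proof (rule integral_mono_AE)
    show "integrable \<nu> (\<lambda>s. norm (remainder s))"
      using int by (rule integrable_norm)
    show "AE s in \<nu>. norm (remainder s) \<le> \<bar>\<theta>\<bar> ^ 3 / 6 * (s ^ 3 * exp (- (w * s)))"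
      using AE_pos
    proof eventually_elim
      case (elim s)
      have 1: "(\<Sum>k\<le>2. (\<i> * (\<theta> * s)) ^ k / fact k) = 1 + \<i> * of_real (\<theta> * s) - of_real ((\<theta> * s) ^ 2 / 2)"
        by (auto simp: eval_nat_numeral complex_eq_iff)
      have 2: "complex_of_real (\<theta> ^ 2 / 2 * (s ^ 2 * exp (- (w * s)))) = exp (- (w * s)) *\<^sub>R of_real ((\<theta> * s) ^ 2 / 2)"
        by (simp only: scaleR_conv_of_real of_real_mult[symmetric] power_mult_distrib) (simp add: mult_ac)
      have "remainder s = exp (- (w * s)) *\<^sub>R (iexp (\<theta> * s) - (\<Sum>k\<le>2. (\<i> * (\<theta> * s)) ^ k / fact k))"
        unfolding remainder_def 1 2 scaleR_add_right[symmetric] by (simp only: diff_diff_eq2 diff_diff_eq diff_add_eq)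
      then have "norm (remainder s) = exp (- (w * s)) * norm (iexp (\<theta> * s) - (\<Sum>k\<le>2. (\<i> * (\<theta> * s)) ^ k / fact k))"
        by simp
      also have "\<dots> \<le> exp (- (w * s)) * (\<bar>\<theta> * s\<bar> ^ Suc 2 / fact (Suc 2))"
        using iexp_approx1[of "\<theta> * s" 2] by (intro mult_left_mono) auto
      also have "\<dots> = \<bar>\<theta>\<bar> ^ 3 / 6 * (s ^ 3 * exp (- (w * s)))"
        using elim by (simp add: abs_mult power_mult_distrib fact_numeral)
      finally show "norm (remainder s) \<le> \<bar>\<theta>\<bar> ^ 3 / 6 * (s ^ 3 * exp (- (w * s)))" .
    qed
  qed (use assms in \<open>auto intro!: integrable_mult_right integrable_moment\<close>)
  also have "\<dots> = \<bar>\<theta>\<bar> ^ 3 / 6 * moment 3 w" by (simp add: moment_def)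
  finally show ?thesis by (simp only: eq)
qed


end

section \<open>The Gaussian limit of the scaled inversion integral\<close>

lemma integrable_inverse_1_plus_sq: "integrable lborel (\<lambda>y::real. B / (1 + y ^ 2))"
proof -
  have "einterval (-\<infinity>) \<infinity> = UNIV" by auto
  then have "integrable lborel (\<lambda>y::real. inverse (1 + y ^ 2))"
    using integrable_inverse_1_plus_square
    by (simp add: set_integrable_def)
  then show ?thesis by (simp add: divide_inverse)
qed

lemma integral_gaussian: "(CLBINT y. exp (- of_real (y ^ 2 / 2))) = of_real (sqrt (2 * pi))"
proof -
  have "(LBINT y. std_normal_density y) = 1"
    using integral_normal_density[of 1 0] by simp
  then have "(LBINT y. 1 / sqrt (2 * pi) * exp (- (y ^ 2 / 2))) = 1"
    by (simp only: std_normal_density_def minus_divide_left)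
  then have "1 / sqrt (2 * pi) * (LBINT y. exp (- (y ^ 2 / 2))) = 1"
    by (simp only: integral_mult_right_zero)
  moreover have "I = s" if "1 / s * I = 1" for I s :: real
    using that by (cases "s = 0") (auto simp: field_simps)
  ultimately have "(LBINT y. exp (- (y ^ 2 / 2))) = sqrt (2 * pi)"
    by blast
  moreover have "(CLBINT y. exp (- of_real (y ^ 2 / 2))) = of_real (LBINT y. exp (- (y ^ 2 / 2)))"
    by (simp flip: integral_complex_of_real exp_of_real)
  ultimately show ?thesis by simp
qed

context wlsc_levy_measure
begin

text \<open>The dominating function. In the variable \<open>y = \<theta> * sqrt (t * moment 2 w)\<close> the two lower bounds for
  the real part both become a constant times \<open>\<bar>y\<bar> powr \<alpha>\<close> for \<open>\<bar>y\<bar> \<ge> 1\<close>, uniformly in \<open>t\<close> and \<open>w\<close>,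
  as soon as \<open>w * sqrt (t * moment 2 w) \<ge> 1\<close>. The resulting stretched exponential is replaced by a
  multiple of \<open>1 / (1 + y\<^sup>2)\<close>.\<close>

lemma norm_exp_scaled_cgf_le:
  obtains B where "\<And>t w y. t > 0 \<Longrightarrow> w > x0 \<Longrightarrow> t * (w ^ 2 * moment 2 w) \<ge> 1 \<Longrightarrow>
     norm (exp (of_real t * cgf w (y / sqrt (t * moment 2 w)))) \<le> B / (1 + y ^ 2)"
proof -
  obtain \<kappa> where \<kappa>: "\<kappa> > 0"
    "\<And>w \<theta>. w > x0 \<Longrightarrow> \<bar>\<theta>\<bar> \<le> w \<Longrightarrow> \<kappa> * \<theta> ^ 2 * moment 2 w \<le> (LINT s|\<nu>. exp (- (w * s)) * (1 - cos (\<theta> * s)))"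
    "\<And>w \<theta>. w > x0 \<Longrightarrow> w \<le> \<bar>\<theta>\<bar> \<Longrightarrow>
      \<kappa> * \<theta> ^ 2 * (c * (\<bar>\<theta>\<bar> / w) powr (\<alpha> - 2) * moment 2 w) \<le> (LINT s|\<nu>. exp (- (w * s)) * (1 - cos (\<theta> * s)))"
    by (rule tilted_cos_lower_bound) blast
  \<comment> \<open>\<open>k\<close> serves both frequency ranges; \<open>n\<close> makes \<open>(\<bar>y\<bar> powr \<alpha>) ^ n\<close> dominate \<open>y\<^sup>2\<close>.\<close>
  define k where "k = \<kappa> * min 1 c"
  have k: "k > 0" "k \<le> \<kappa>" "k \<le> \<kappa> * c" using \<kappa>(1) c_pos by (auto simp: k_def min_def)
  obtain n :: nat where n: "2 / \<alpha> \<le> n" using real_arch_simple by blast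
  define B where "B = 2 + fact n / k ^ n"
  have B: "B \<ge> 2" using k by (simp add: B_def)
  show ?thesis
  proof
    fix t w y :: real assume t: "t > 0" and w: "w > x0" and R: "t * (w ^ 2 * moment 2 w) \<ge> 1"
    have w0: "w > 0" using w x0_nonneg by simp
    define \<sigma> where "\<sigma> = sqrt (t * moment 2 w)"
    have \<sigma>: "\<sigma> > 0" "\<sigma> ^ 2 = t * moment 2 w"
      using t moment_2_pos[OF w0] by (auto simp: \<sigma>_def)
    have R1: "w * \<sigma> \<ge> 1"
    proof -
      have "1 ^ 2 \<le> (w * \<sigma>) ^ 2" using R \<sigma> by (simp add: power_mult_distrib mult_ac)
      then show ?thesis by (rule power2_le_imp_le) (use w0 \<sigma> in auto)
    qed
    define A where "A = (LINT s|\<nu>. exp (- (w * s)) * (1 - cos (y / \<sigma> * s)))"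
    have A0: "A \<ge> 0" unfolding A_def by (rule Bochner_Integration.integral_nonneg) simp
    have norm: "norm (exp (of_real t * cgf w (y / \<sigma>))) = exp (- (t * A))"
      using Re_cgf[OF w0, of "y / \<sigma>"] by (simp add: A_def)
    have "exp (- (t * A)) * (1 + y ^ 2) \<le> B"
    proof (cases "\<bar>y\<bar> \<le> 1")
      case True
      then have "y ^ 2 \<le> 1" by (simp add: abs_square_le_1)
      then have "exp (- (t * A)) * (1 + y ^ 2) \<le> 1 * 2"
        using t A0 by (intro mult_mono) auto
      then show ?thesis using B by simp
    next
      case False
      then have y: "\<bar>y\<bar> \<ge> 1" by simp
      have sq: "y ^ 2 = \<bar>y\<bar> powr 2" using y by (simp add: powr_numeral)
      have tA: "k * \<bar>y\<bar> powr \<alpha> \<le> t * A"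
      proof (cases "\<bar>y / \<sigma>\<bar> \<le> w")
        case True
        have "k * \<bar>y\<bar> powr \<alpha> \<le> \<kappa> * y ^ 2"
          unfolding sq using k \<kappa>(1) y alpha by (intro mult_mono powr_mono) auto
        also have "\<dots> = t * (\<kappa> * (y / \<sigma>) ^ 2 * moment 2 w)"
          using \<sigma> t moment_2_pos[OF w0] by (simp add: power_divide)
        also have "\<dots> \<le> t * A"
          unfolding A_def using t w True by (intro mult_left_mono \<kappa>) auto
        finally show ?thesis .
      next
        case False
        have "1 \<le> (w * \<sigma>) powr (2 - \<alpha>)"
          using R1 alpha by (intro ge_one_powr_ge_zero) auto
        then have "k * \<bar>y\<bar> powr \<alpha> \<le> (\<kappa> * c) * (\<bar>y\<bar> powr \<alpha> * (w * \<sigma>) powr (2 - \<alpha>))"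
          using k \<kappa>(1) c_pos mult_left_mono[of 1 "(w * \<sigma>) powr (2 - \<alpha>)" "\<bar>y\<bar> powr \<alpha>"]
          by (intro mult_mono) auto
        also have "\<bar>y\<bar> powr \<alpha> * (w * \<sigma>) powr (2 - \<alpha>) = y ^ 2 * (\<bar>y\<bar> / (w * \<sigma>)) powr (\<alpha> - 2)"
          unfolding sq using w0 \<sigma> y by (simp add: powr_divide powr_diff field_simps)
        also have "(\<kappa> * c) * (y ^ 2 * (\<bar>y\<bar> / (w * \<sigma>)) powr (\<alpha> - 2)) =
            t * (\<kappa> * (y / \<sigma>) ^ 2 * (c * (\<bar>y / \<sigma>\<bar> / w) powr (\<alpha> - 2) * moment 2 w))"
          using \<sigma> t moment_2_pos[OF w0] by (simp add: power_divide mult_ac)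
        also have "\<dots> \<le> t * A"
          unfolding A_def using t w False by (intro mult_left_mono \<kappa>) auto
        finally show ?thesis .
      qed
      have "y ^ 2 \<le> (\<bar>y\<bar> powr \<alpha>) ^ n"
      proof -
        have "2 \<le> \<alpha> * n" using n alpha by (simp add: field_simps)
        then have "\<bar>y\<bar> powr 2 \<le> \<bar>y\<bar> powr (\<alpha> * n)" using y by (intro powr_mono) auto
        then show ?thesis unfolding sq using y by (simp add: powr_powr[symmetric] powr_realpow)
      qed
      then have "exp (- (t * A)) * y ^ 2 \<le> exp (- (k * \<bar>y\<bar> powr \<alpha>)) * (\<bar>y\<bar> powr \<alpha>) ^ n"
        using tA by (intro mult_mono) auto
      also have "\<dots> \<le> fact n / k ^ n"
        using power_times_exp_le[of k "\<bar>y\<bar> powr \<alpha>" n] k by (simp add: mult.commute)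
      finally have "exp (- (t * A)) * y ^ 2 \<le> fact n / k ^ n" .
      moreover have "exp (- (t * A)) \<le> 1" using t A0 by simp
      ultimately show ?thesis unfolding B_def distrib_left by linarith
    qed
    moreover have "1 + y ^ 2 > 0" by (simp add: add_pos_nonneg)
    ultimately show "norm (exp (of_real t * cgf w (y / sqrt (t * moment 2 w)))) \<le> B / (1 + y ^ 2)"
      using norm by (simp add: \<sigma>_def pos_le_divide_eq)
  qed
qed

lemma borel_measurable_scaled_cgf:
  assumes "v > 0"
  shows "(\<lambda>y. exp (of_real t * cgf v (y / s))) \<in> borel_measurable borel"
proof -
  have [measurable]: "cgf v \<in> borel_measurable borel"
    using continuous_cgf[OF assms] by (rule borel_measurable_continuous_onI)
  show ?thesis by measurable
qed

context
  fixes w :: "real \<Rightarrow> real"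
  assumes w_at_top: "filterlim w at_top at_top"
begin

lemma scale_at_top: "filterlim (\<lambda>t. (w t) ^ 2 * moment 2 (w t)) at_top at_top"
proof -
  obtain C where C: "C > 0" "\<And>w. w \<ge> x0 + 1 \<Longrightarrow> C * w powr \<alpha> \<le> w ^ 2 * moment 2 w"
    by (rule moment_2_lower_bound) blast
  have "filterlim (\<lambda>v. C * v powr \<alpha>) at_top at_top"
    using C(1) alpha by real_asymp
  from filterlim_compose[OF this w_at_top]
  show ?thesis
  proof (rule filterlim_at_top_mono)
    have "\<forall>\<^sub>F t in at_top. w t \<ge> x0 + 1"
      using w_at_top by (simp add: filterlim_at_top)
    then show "\<forall>\<^sub>F t in at_top. C * w t powr \<alpha> \<le> (w t) ^ 2 * moment 2 (w t)"
      by eventually_elim (rule C)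
  qed
qed

lemma eventually_admissible:
  "\<forall>\<^sub>F t in at_top. t \<ge> 1 \<and> w t > 2 * x0 \<and> w t > x0 \<and> w t > 0 \<and> t * ((w t) ^ 2 * moment 2 (w t)) \<ge> 1"
proof -
  have "\<forall>\<^sub>F t in at_top. (w t) ^ 2 * moment 2 (w t) \<ge> 1"
    using scale_at_top by (simp add: filterlim_at_top)
  moreover have "\<forall>\<^sub>F t in at_top. w t > 2 * x0" "\<forall>\<^sub>F t in at_top. w t > 0"
    using w_at_top by (simp_all add: filterlim_at_top_dense)
  ultimately show ?thesis
    using eventually_ge_at_top[of "1::real"]
  proof eventually_elim
    case (elim t)
    then have "1 * 1 \<le> t * ((w t) ^ 2 * moment 2 (w t))" by (intro mult_mono) auto
    then show ?case using elim x0_nonneg by auto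
  qed
qed

text \<open>Pointwise Gaussian limit: the quadratic term is exactly \<open>- y\<^sup>2 / 2\<close> by the choice of the scale, and
  for \<open>t \<ge> 1\<close> the third-order remainder is at most \<open>\<bar>y\<bar> ^ 3 / (w * sqrt (moment 2 w))\<close> up to a constant.\<close>

lemma scaled_cgf_tendsto:
  "((\<lambda>t. of_real t * cgf (w t) (y / sqrt (t * moment 2 (w t)))) \<longlongrightarrow> - of_real (y ^ 2 / 2)) at_top"
proof -
  define D where "D = \<bar>y\<bar> ^ 3 / 6 * (2 / (c * 2 powr (\<alpha> - 2)))"
  have "filterlim (\<lambda>t. sqrt ((w t) ^ 2 * moment 2 (w t))) at_top at_top"
    by (rule filterlim_compose[OF sqrt_at_top scale_at_top])
  from tendsto_divide_0[OF tendsto_const filterlim_at_top_imp_at_infinity[OF this], of D]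
  have lim: "((\<lambda>t. D / sqrt ((w t) ^ 2 * moment 2 (w t))) \<longlongrightarrow> 0) at_top" .
  have "\<forall>\<^sub>F t in at_top. norm (of_real t * cgf (w t) (y / sqrt (t * moment 2 (w t))) - - of_real (y ^ 2 / 2))
      \<le> D / sqrt ((w t) ^ 2 * moment 2 (w t))"
    using eventually_admissible
  proof eventually_elim
    case (elim t)
    define m where "m = moment 2 (w t)"
    define \<sigma> where "\<sigma> = sqrt (t * m)"
    have m: "m > 0" using moment_2_pos[of "w t"] elim by (simp add: m_def)
    have \<sigma>: "\<sigma> > 0" "\<sigma> ^ 2 = t * m" using elim m by (auto simp: \<sigma>_def)
    have "of_real t * cgf (w t) (y / \<sigma>) - - of_real (y ^ 2 / 2) = of_real t * (cgf (w t) (y / \<sigma>) + of_real ((y / \<sigma>) ^ 2 * m / 2))"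
    proof -
      have "y ^ 2 / 2 = t * ((y / \<sigma>) ^ 2 * m / 2)" using \<sigma> elim m by (simp add: power_divide)
      then show ?thesis by (simp only: of_real_mult distrib_left diff_minus_eq_add)
    qed
    then have "norm (of_real t * cgf (w t) (y / \<sigma>) - - of_real (y ^ 2 / 2)) = t * norm (cgf (w t) (y / \<sigma>) + of_real ((y / \<sigma>) ^ 2 * m / 2))"
      using elim by (simp only: norm_mult norm_of_real) simp
    also have "\<dots> \<le> t * (\<bar>y / \<sigma>\<bar> ^ 3 / 6 * moment 3 (w t))"
      using elim cgf_approx[of "w t" "y / \<sigma>"] by (intro mult_left_mono) (auto simp: m_def)
    also have "\<dots> \<le> t * (\<bar>y / \<sigma>\<bar> ^ 3 / 6 * (2 / (c * 2 powr (\<alpha> - 2)) * (m / w t)))"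
      unfolding m_def using elim by (intro mult_left_mono moment_3_le) auto
    also have "\<dots> = D * (t * m / \<sigma> ^ 3) / w t"
      using \<sigma> by (simp add: D_def power_divide mult_ac)
    also have "t * m / \<sigma> ^ 3 = 1 / \<sigma>"
      using \<sigma> by (simp add: \<sigma>(2)[symmetric] power2_eq_square power3_eq_cube)
    also have "D * (1 / \<sigma>) / w t \<le> D / sqrt ((w t) ^ 2 * m)"
    proof -
      have "sqrt ((w t) ^ 2 * m) \<le> w t * \<sigma>"
        using elim m by (simp add: \<sigma>_def real_sqrt_mult)
      then have "D / (w t * \<sigma>) \<le> D / sqrt ((w t) ^ 2 * m)"
        using elim m \<sigma> c_pos by (intro divide_left_mono) (auto simp: D_def)
      then show ?thesis by (simp add: mult_ac)
    qed
    finally show ?case by (simp only: m_def \<sigma>_def)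
  qed
  then have "((\<lambda>t. of_real t * cgf (w t) (y / sqrt (t * moment 2 (w t))) - - of_real (y ^ 2 / 2)) \<longlongrightarrow> 0) at_top"
    by (rule Lim_null_comparison[OF _ lim])
  then show ?thesis by (rule LIM_zero_cancel)
qed

lemma integral_scaled_cgf_tendsto:
  "((\<lambda>t. CLBINT y. exp (of_real t * cgf (w t) (y / sqrt (t * moment 2 (w t))))) \<longlongrightarrow> of_real (sqrt (2 * pi))) at_top"
proof -
  obtain B where B: "\<And>t w y. t > 0 \<Longrightarrow> w > x0 \<Longrightarrow> t * (w ^ 2 * moment 2 w) \<ge> 1 \<Longrightarrow>
     norm (exp (of_real t * cgf w (y / sqrt (t * moment 2 w)))) \<le> B / (1 + y ^ 2)"
    by (rule norm_exp_scaled_cgf_le) blast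
  \<comment> \<open>For small \<open>t\<close> the point \<open>w t\<close> need not be positive; the value \<open>0\<close> there keeps every \<open>s t\<close> measurable.\<close>
  define s where "s = (\<lambda>t y. if w t > 0 then exp (of_real t * cgf (w t) (y / sqrt (t * moment 2 (w t)))) else 0)"
  have ev: "\<forall>\<^sub>F t in at_top. w t > 0"
    using eventually_admissible by eventually_elim auto
  have "((\<lambda>t. CLBINT y. s t y) \<longlongrightarrow> (CLBINT y. exp (- of_real (y ^ 2 / 2)))) at_top"
  proof (rule integral_dominated_convergence_at_top[where w = "\<lambda>y. B / (1 + y ^ 2)"])
    show "s t \<in> borel_measurable lborel" for t
      using borel_measurable_scaled_cgf[of "w t"] by (cases "w t > 0") (auto simp: s_def)
    show "AE y in lborel. ((\<lambda>t. s t y) \<longlongrightarrow> exp (- of_real (y ^ 2 / 2))) at_top"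
    proof (rule AE_I2)
      fix y :: real
      have "((\<lambda>t. exp (of_real t * cgf (w t) (y / sqrt (t * moment 2 (w t))))) \<longlongrightarrow> exp (- of_real (y ^ 2 / 2))) at_top"
        by (intro tendsto_exp scaled_cgf_tendsto)
      then show "((\<lambda>t. s t y) \<longlongrightarrow> exp (- of_real (y ^ 2 / 2))) at_top"
        by (rule Lim_transform_eventually) (use ev in \<open>auto simp: s_def elim!: eventually_mono\<close>)
    qed
    show "\<forall>\<^sub>F t in at_top. AE y in lborel. norm (s t y) \<le> B / (1 + y ^ 2)"
      using eventually_admissible
      by eventually_elim (use B in \<open>auto simp: s_def\<close>)
  qed (auto intro: integrable_inverse_1_plus_sq)
  then show ?thesis
    unfolding integral_gaussian
    by (rule Lim_transform_eventually) (use ev in \<open>auto simp: s_def elim!: eventually_mono\<close>)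
qed

lemma eventually_integrable_scaled_cgf:
  "\<forall>\<^sub>F t in at_top. complex_integrable lborel (\<lambda>y. exp (of_real t * cgf (w t) (y / sqrt (t * moment 2 (w t)))))"
proof -
  obtain B where B: "\<And>t w y. t > 0 \<Longrightarrow> w > x0 \<Longrightarrow> t * (w ^ 2 * moment 2 w) \<ge> 1 \<Longrightarrow>
     norm (exp (of_real t * cgf w (y / sqrt (t * moment 2 w)))) \<le> B / (1 + y ^ 2)"
    by (rule norm_exp_scaled_cgf_le) blast
  show ?thesis
    using eventually_admissible
  proof eventually_elim
    case (elim t)
    show ?case
    proof (rule Bochner_Integration.integrable_bound)
      show "(\<lambda>y. exp (of_real t * cgf (w t) (y / sqrt (t * moment 2 (w t))))) \<in> borel_measurable lborel"
        using borel_measurable_scaled_cgf[of "w t"] elim by simp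
      show "AE y in lborel. norm (exp (of_real t * cgf (w t) (y / sqrt (t * moment 2 (w t))))) \<le> norm (B / (1 + y ^ 2))"
      proof (rule AE_I2)
        fix y
        have "norm (exp (of_real t * cgf (w t) (y / sqrt (t * moment 2 (w t))))) \<le> B / (1 + y ^ 2)"
          using elim by (intro B) auto
        also have "\<dots> \<le> norm (B / (1 + y ^ 2))" by (simp only: real_norm_def abs_ge_self)
        finally show "norm (exp (of_real t * cgf (w t) (y / sqrt (t * moment 2 (w t))))) \<le> norm (B / (1 + y ^ 2))" .
      qed
    qed (rule integrable_inverse_1_plus_sq)
  qed
qed

end

end

section \<open>The tilted density\<close>

lemma one_islimpt_pos_reals: "(1::complex) islimpt of_real ` {0<..}"
  unfolding islimpt_approachable
proof (intro allI impI)
  fix e :: real assume "e > 0"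
  then show "\<exists>z\<in>complex_of_real ` {0<..}. z \<noteq> 1 \<and> dist z 1 < e"
    by (intro bexI[of _ "of_real (1 + e / 2)"] imageI) (auto simp: dist_norm)
qed

context levy_measure_space
begin

text \<open>The Laplace transform on the open half-plane, by analytic continuation from the positive reals.\<close>

lemma complex_laplace_transform:
  assumes "prob_space M" and X[measurable]: "X \<in> borel_measurable M" and nonneg: "AE \<omega> in M. 0 \<le> X \<omega>"
    and laplace: "\<And>l. l > 0 \<Longrightarrow> (LINT \<omega>|M. exp (- (l * X \<omega>))) = exp (- (t * (LINT s|\<nu>. 1 - exp (- (l * s)))))"
    and z: "Re z > 0"
  shows "(CLINT \<omega>|M. exp (- (z * of_real (X \<omega>)))) = exp (- (of_real t * exponent z))"
proof -
  interpret prob_space M by fact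
  define L where "L = (\<lambda>z. CLINT \<omega>|M. exp (- (z * of_real (X \<omega>))))"
  have "(L has_field_derivative (CLINT \<omega>|M. - of_real (X \<omega>) * exp (- (z * of_real (X \<omega>))))) (at z)" if z: "Re z > 0" for z
    unfolding L_def
  proof (rule has_field_derivative_integral[where r = "Re z / 2" and B = "\<lambda>_. 1 / (Re z / 2)"
        and F' = "\<lambda>z \<omega>. - of_real (X \<omega>) * exp (- (z * of_real (X \<omega>)))"])
    have *: "Re y \<ge> Re z / 2" if "y \<in> ball z (Re z / 2)" for y
      using that abs_Re_le_cmod[of "z - y"] by (auto simp: dist_norm abs_if split: if_splits)
    show "complex_integrable M (\<lambda>\<omega>. exp (- (y * of_real (X \<omega>))))" if "y \<in> ball z (Re z / 2)" for y
    proof (rule integrable_const_bound)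
      show "AE \<omega> in M. norm (exp (- (y * of_real (X \<omega>)))) \<le> 1"
        using nonneg by eventually_elim (use *[OF that] z in simp)
    qed simp
    show "AE \<omega> in M. \<forall>y\<in>ball z (Re z / 2). ((\<lambda>y. exp (- (y * of_real (X \<omega>)))) has_field_derivative
        - of_real (X \<omega>) * exp (- (y * of_real (X \<omega>)))) (at y) \<and> norm (- of_real (X \<omega>) * exp (- (y * of_real (X \<omega>)))) \<le> 1 / (Re z / 2)"
      using nonneg
    proof eventually_elim
      case (elim \<omega>)
      show ?case
      proof (intro ballI conjI)
        fix y assume y: "y \<in> ball z (Re z / 2)"
        show "((\<lambda>y. exp (- (y * of_real (X \<omega>)))) has_field_derivative - of_real (X \<omega>) * exp (- (y * of_real (X \<omega>)))) (at y)"
          by (auto intro!: derivative_eq_intros)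
        have "exp (- (Re y * X \<omega>)) \<le> exp (- (Re z / 2 * X \<omega>))"
          using *[OF y] elim by (auto intro!: mult_right_mono simp del: times_divide_eq_left)
        then have "X \<omega> * exp (- (Re y * X \<omega>)) \<le> X \<omega> * exp (- (Re z / 2 * X \<omega>))"
          using elim by (rule mult_left_mono)
        also have "\<dots> \<le> 1 / (Re z / 2)"
          using power_times_exp_le[of "Re z / 2" "X \<omega>" 1] elim z by simp
        finally show "norm (- of_real (X \<omega>) * exp (- (y * of_real (X \<omega>)))) \<le> 1 / (Re z / 2)"
          using elim by (simp add: norm_mult)
      qed
    qed
  qed (use z in auto)
  then have "L holomorphic_on {z. Re z > 0}"
    by (intro holomorphic_onI) (auto simp: field_differentiable_def intro: has_field_derivative_at_within)
  then have hol: "(\<lambda>z. L z - exp (- (of_real t * exponent z))) holomorphic_on {z. Re z > 0}"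
    by (intro holomorphic_intros exponent_holomorphic)
  have "L z - exp (- (of_real t * exponent z)) = 0"
  proof (rule analytic_continuation[OF hol, where U = "of_real ` {0<..}" and \<xi> = 1])
    show "open {z. 0 < Re z}" by (rule open_halfspace_Re_gt)
    show "connected {z. 0 < Re z}" by (intro convex_connected convex_halfspace_Re_gt)
    fix y :: complex assume "y \<in> of_real ` {0<..}"
    then obtain l where l: "l > 0" "y = of_real l" by auto
    have "L y = of_real (LINT \<omega>|M. exp (- (l * X \<omega>)))"
      unfolding L_def l(2) by (simp flip: integral_complex_of_real exp_of_real)
    also have "\<dots> = exp (- (of_real t * exponent y))"
      using l(1) by (simp add: laplace l(2) exponent_of_real flip: exp_of_real)
    finally show "L y - exp (- (of_real t * exponent y)) = 0" by simp
  qed (use z one_islimpt_pos_reals in auto)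
  then show ?thesis by (simp add: L_def)
qed

text \<open>If the law of \<open>X\<close> tilted by \<open>exp (- v s)\<close> has an integrable characteristic function \<open>\<psi>\<close>, then
  \<open>X\<close> has a continuous density, obtained by inverting \<open>\<psi>\<close> and undoing the tilt.\<close>

lemma tilted_continuous_density:
  fixes a v :: real
  assumes "prob_space M" and X[measurable]: "X \<in> borel_measurable M" and nonneg: "AE \<omega> in M. 0 \<le> X \<omega>"
    and laplace: "\<And>l. l > 0 \<Longrightarrow> (LINT \<omega>|M. exp (- (l * X \<omega>))) = exp (- (t * (LINT s|\<nu>. 1 - exp (- (l * s)))))"
    and v: "v > 0"
  defines "a \<equiv> t * (LINT s|\<nu>. 1 - exp (- (v * s)))"
  defines "\<psi> \<equiv> (\<lambda>u. exp (of_real t * (exponent (of_real v) - exponent (of_real v - \<i> * of_real u))))"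
  assumes int: "complex_integrable lborel \<psi>"
  shows "is_continuous_density M X (\<lambda>y. exp (v * y - a) * (Re (CLBINT u. iexp (- (u * y)) * \<psi> u) / (2 * pi)))"
proof -
  interpret M: prob_space M by fact
  define D where "D = distr M borel X"
  have [measurable_cong, simp]: "sets D = sets borel" and [simp]: "space D = UNIV" by (simp_all add: D_def)
  define g where "g = (\<lambda>s. exp (a - v * s))"
  have g_eq: "g s = exp a * exp (- (v * s))" for s
    by (simp add: g_def exp_diff exp_minus divide_inverse)
  have [measurable]: "g \<in> borel_measurable borel" unfolding g_def by measurable
  define N where "N = density D (\<lambda>s. ennreal (g s))"
  have int_exp: "integrable M (\<lambda>\<omega>. exp (- (v * X \<omega>)))"
  proof (rule M.integrable_const_bound)
    show "AE \<omega> in M. norm (exp (- (v * X \<omega>))) \<le> 1"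
      using nonneg by eventually_elim (use v in simp)
  qed simp
  have "prob_space N"
  proof (rule prob_spaceI)
    have "emeasure N (space N) = (\<integral>\<^sup>+s. ennreal (g s) \<partial>D)"
      unfolding N_def by (subst emeasure_density) (auto intro!: nn_integral_cong)
    also have "\<dots> = (\<integral>\<^sup>+\<omega>. ennreal (g (X \<omega>)) \<partial>M)"
      by (simp add: D_def nn_integral_distr)
    also have "\<dots> = ennreal (LINT \<omega>|M. g (X \<omega>))"
      using int_exp by (intro nn_integral_eq_integral) (auto simp: g_eq intro!: integrable_mult_right)
    also have "(LINT \<omega>|M. g (X \<omega>)) = exp a * (LINT \<omega>|M. exp (- (v * X \<omega>)))"
      by (simp only: g_eq integral_mult_right_zero)
    also have "\<dots> = 1" using laplace[OF v] by (simp add: a_def flip: exp_add)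
    finally show "emeasure N (space N) = 1" by simp
  qed
  then interpret N: prob_space N .
  interpret N: real_distribution N by unfold_locales (auto simp: N_def)
  have char_N: "char N u = \<psi> u" for u
  proof -
    have "char N u = (CLINT s|D. g s *\<^sub>R iexp (u * s))"
      unfolding char_def N_def by (subst integral_density) (auto simp: g_def)
    also have "\<dots> = (CLINT \<omega>|M. g (X \<omega>) *\<^sub>R iexp (u * X \<omega>))"
      unfolding D_def by (subst integral_distr) auto
    also have "(\<lambda>\<omega>. g (X \<omega>) *\<^sub>R iexp (u * X \<omega>)) = (\<lambda>\<omega>. exp (of_real a) * exp (- ((of_real v - \<i> * of_real u) * of_real (X \<omega>))))"
      by (simp add: g_def scaleR_conv_of_real algebra_simps flip: exp_add exp_of_real)
    also have "(CLINT \<omega>|M. \<dots> \<omega>) = exp (of_real a) * exp (- (of_real t * exponent (of_real v - \<i> * of_real u)))"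
      using v by (simp add: complex_laplace_transform[OF assms(1) X nonneg laplace])
    also have "\<dots> = \<psi> u"
      using v by (simp add: \<psi>_def a_def exponent_of_real algebra_simps flip: exp_add)
    finally show ?thesis .
  qed
  then have char_eq: "char N = \<psi>" by auto
  have char_int: "integrable lborel (char N)" using int by (simp add: char_eq)
  note cont = N.continuous_inversion_density[OF char_int]
    and nonneg' = N.inversion_density_nonneg[OF char_int]
    and dens = N.density_inversion_density[OF char_int]
  have [measurable]: "inversion_density N \<in> borel_measurable borel"
    using cont by (rule borel_measurable_continuous_onI)
  define f where "f = (\<lambda>y. exp (v * y - a) * inversion_density N y)"
  have [measurable]: "f \<in> borel_measurable borel" unfolding f_def by measurable
  have "distr M lborel X = D" unfolding D_def by (rule distr_cong) auto
  also have "D = density D (\<lambda>s. ennreal (g s) * ennreal (exp (v * s - a)))"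
    by (simp add: g_def density_1 flip: ennreal_mult exp_add)
  also have "\<dots> = density N (\<lambda>s. ennreal (exp (v * s - a)))"
    unfolding N_def by (intro density_density_eq[symmetric]) auto
  also have "\<dots> = density (density lborel (\<lambda>s. ennreal (inversion_density N s))) (\<lambda>s. ennreal (exp (v * s - a)))"
    by (simp flip: dens)
  also have "\<dots> = density lborel (\<lambda>s. ennreal (inversion_density N s) * ennreal (exp (v * s - a)))"
    by (intro density_density_eq) auto
  also have "\<dots> = density lborel (\<lambda>s. ennreal (f s))"
    by (simp add: f_def mult.commute nonneg' flip: ennreal_mult)
  finally have "is_continuous_density M X f"
    unfolding is_continuous_density_def distributed_def
    using nonneg' cont by (auto simp: f_def intro!: continuous_intros)
  then show ?thesis
    by (simp add: f_def inversion_density_def char_eq)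
qed

end

section \<open>The asymptotics of the transition density\<close>

lemma WLSC_mono_exponent:
  assumes "f \<in> WLSC \<tau> c x0" "\<sigma> \<le> \<tau>" "c > 0" "x0 \<ge> 0"
  shows "f \<in> WLSC \<sigma> c x0"
  unfolding WLSC_def
proof (intro CollectI conjI allI impI)
  show "f x \<ge> 0" if "x > 0" for x using assms(1) that by (simp add: WLSC_def)
  fix l x :: real assume l: "l \<ge> 1" and x: "x > x0"
  have "f x \<ge> 0" using assms x by (simp add: WLSC_def)
  then have "c * l powr \<sigma> * f x \<le> c * l powr \<tau> * f x"
    using assms l by (intro mult_right_mono mult_left_mono powr_mono) auto
  also have "\<dots> \<le> f (l * x)" using assms(1) l x by (simp add: WLSC_def)
  finally show "c * l powr \<sigma> * f x \<le> f (l * x)" .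
qed

lemma subordinator_AE_nonneg:
  assumes "subordinator M T" "t \<ge> 0"
  shows "AE \<omega> in M. 0 \<le> T t \<omega>"
proof -
  have "AE \<omega> in M. mono_on {0..} (\<lambda>t. T t \<omega>)" "AE \<omega> in M. T 0 \<omega> = 0"
    using assms(1) by (simp_all add: subordinator_def levy_process_def)
  then show ?thesis
  proof eventually_elim
    case (elim \<omega>)
    then show ?case using mono_onD[of "{0..}" "\<lambda>t. T t \<omega>" 0 t] assms(2) by auto
  qed
qed

lemma continuous_density_eq:
  assumes "is_continuous_density M X f"
  shows "continuous_density M X = f"
  unfolding continuous_density_def
  using assms is_continuous_density_unique by (intro the_equality) blast+

theorem corollary3p6:
  fixes M :: "'a measure" and T :: "real \<Rightarrow> 'a \<Rightarrow> real"
    and \<phi> :: "real \<Rightarrow> real" and b :: real and \<nu> :: "real measure"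
    and p :: "real \<Rightarrow> real \<Rightarrow> real" and w :: "real \<Rightarrow> real"
    and \<alpha> c x0 x :: real
  assumes "subordinator M T"
    and "laplace_exponent M T \<phi>"
    and "levy_khintchine \<phi> b \<nu>"
    and "\<exists>l>0. deriv (deriv \<phi>) l \<noteq> 0"
    and "\<And>t. t > 0 \<Longrightarrow> p t = continuous_density M (T t)"
    and "0 < c" "c \<le> 1" "x0 \<ge> 0" "\<alpha> > 0"
    and "(\<lambda>l. - deriv (deriv \<phi>) l) \<in> WLSC (\<alpha> - 2) c x0"
    and "b = 0"
    and "x > 0"
    and "\<And>t. w t = the_inv_into {0<..} (deriv \<phi>) (x / t)"
  shows "((\<lambda>t. p t x * sqrt (t * (- deriv (deriv \<phi>) (w t)))
                * exp (t * (\<phi> (w t) - w t * deriv \<phi> (w t))))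
          \<longlongrightarrow> (2 * pi) powr (- 1 / 2)) at_top"
proof -
  interpret levy_measure_space \<nu>
    using assms(3) by unfold_locales (simp add: levy_khintchine_def)
  have \<phi>: "\<phi> l = (LINT s|\<nu>. 1 - exp (- (l * s)))" if "l \<ge> 0" for l
    using assms(3) \<open>b = 0\<close> that set_integral_eq[of "\<lambda>s. 1 - exp (- l * s)"]
    by (simp add: levy_khintchine_def)
  have d1: "deriv \<phi> l = moment 1 l" if "l > 0" for l
  proof (rule DERIV_imp_deriv)
    show "(\<phi> has_real_derivative moment 1 l) (at l)"
      by (rule has_field_derivative_transform_within_open[OF real_exponent_has_derivative[OF that], of "{0<..}"])
        (use that \<phi> in auto)
  qed
  have d2: "deriv (deriv \<phi>) l = - moment 2 l" if "l > 0" for l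
  proof (rule DERIV_imp_deriv)
    have "(moment 1 has_real_derivative - moment 2 l) (at l)"
      using moment_has_derivative[OF that, of 1] by (simp add: numeral_2_eq_2)
    then show "(deriv \<phi> has_real_derivative - moment 2 l) (at l)"
      by (rule has_field_derivative_transform_within_open[of _ _ _ "{0<..}"])
        (use that d1 in auto)
  qed
  have pos: "moment n l > 0" if "l > 0" "n \<ge> 1" for n l
  proof -
    obtain r where "r > 0" "moment 2 r \<noteq> 0" using assms(4) d2 by auto
    moreover from this have "moment 2 r > 0" using moment_nonneg[of 2 r] by simp
    ultimately show ?thesis using moment_pos_transfer that by blast
  qed
  \<comment> \<open>The estimates need an exponent at most \<open>1\<close>.\<close>
  define \<beta> where "\<beta> = min \<alpha> 1"
  have wlsc: "(\<lambda>l. - deriv (deriv \<phi>) l) \<in> WLSC (\<beta> - 2) c x0"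
    by (rule WLSC_mono_exponent[OF assms(10)]) (use assms in \<open>auto simp: \<beta>_def\<close>)
  interpret wlsc_levy_measure \<nu> c x0 \<beta>
  proof unfold_locales
    fix l y :: real assume "l \<ge> 1" "y > x0"
    then have "y > 0" "l * y > 0"
      and "c * l powr (\<beta> - 2) * - deriv (deriv \<phi>) y \<le> - deriv (deriv \<phi>) (l * y)"
      using \<open>x0 \<ge> 0\<close> wlsc by (auto simp: WLSC_def)
    then show "c * l powr (\<beta> - 2) * moment 2 y \<le> moment 2 (l * y)" by (simp add: d2)
  qed (use assms pos in \<open>auto simp: \<beta>_def\<close>)

  have decreasing: "moment 1 l2 < moment 1 l1" if "0 < l1" "l1 < l2" for l1 l2
  proof (rule DERIV_neg_imp_decreasing[OF that(2)])
    fix r assume "l1 \<le> r" "r \<le> l2"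
    then have "r > 0" using that by simp
    then show "\<exists>d. (moment 1 has_real_derivative d) (at r) \<and> d < 0"
      using moment_has_derivative[of r 1] pos[of r 2]
      by (intro exI[of _ "- moment 2 r"]) (simp add: numeral_2_eq_2)
  qed
  have inj: "inj_on (deriv \<phi>) {0<..}"
    using decreasing by (intro linorder_inj_onI) (force simp: d1)+
  have w_inverse: "w t > 0 \<and> moment 1 (w t) = x / t" if "x / t < moment 1 1" "t > 0" for t
  proof -
    have "x / t > 0" using that \<open>x > 0\<close> by simp
    then have "\<forall>\<^sub>F l in at_top. moment 1 l < x / t"
      using moment_1_tendsto_0 by (intro order_tendstoD)
    then have "\<forall>\<^sub>F l in at_top. moment 1 l < x / t \<and> l \<ge> 1"
      using eventually_ge_at_top[of "1::real"] by eventually_elim auto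
    then obtain l where l: "moment 1 l < x / t" "l \<ge> 1"
      using eventually_happens'[OF trivial_limit_at_top_linorder] by blast
    have "\<exists>r\<ge>1. r \<le> l \<and> moment 1 r = x / t"
    proof (rule IVT2)
      show "\<forall>r. 1 \<le> r \<and> r \<le> l \<longrightarrow> isCont (moment 1) r"
        by (auto intro!: DERIV_isCont[OF moment_has_derivative])
    qed (use l that in auto)
    then obtain r where "r \<ge> 1" "moment 1 r = x / t" by blast
    then have "x / t \<in> deriv \<phi> ` {0<..}" by (intro image_eqI[of _ _ r]) (auto simp: d1)
    then have "w t \<in> {0<..}" "deriv \<phi> (w t) = x / t"
      unfolding assms(13)
      using the_inv_into_into[OF inj _ order_refl] f_the_inv_into_f[OF inj] by blast+
    then show ?thesis by (simp add: d1)
  qed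
  have small: "\<forall>\<^sub>F t in at_top. x / t < y" if "y > 0" for y
  proof -
    have "((\<lambda>t. x / t) \<longlongrightarrow> 0) at_top" by real_asymp
    then show ?thesis using that by (rule order_tendstoD)
  qed
  have w_eq: "\<forall>\<^sub>F t in at_top. w t > 0 \<and> moment 1 (w t) = x / t"
    using small[OF pos[OF zero_less_one order_refl]] eventually_gt_at_top[of 0]
    by eventually_elim (use w_inverse in auto)
  have w_at_top: "filterlim w at_top at_top"
    unfolding filterlim_at_top_dense
  proof
    fix Z :: real
    define Y where "Y = max Z 1"
    have Y: "Y > 0" "Z \<le> Y" by (auto simp: Y_def)
    have "\<forall>\<^sub>F t in at_top. x / t < moment 1 Y" using small pos Y by simp
    then show "\<forall>\<^sub>F t in at_top. Z < w t"
      using w_eq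
    proof eventually_elim
      case (elim t)
      show ?case
      proof (rule ccontr)
        assume "\<not> ?thesis"
        then have "w t \<le> Y" using Y by simp
        then have "moment 1 Y \<le> moment 1 (w t)"
          using decreasing[of "w t" Y] elim by (cases "w t = Y") auto
        then show False using elim by simp
      qed
    qed
  qed

  \<comment> \<open>Inverting at \<open>x = t * moment 1 (w t)\<close>, the mean of the tilted law, and rescaling the frequency
    identifies the quantity in question with the real part of \<open>G t\<close> divided by \<open>2 * \<pi>\<close>.\<close>
  define G where "G = (\<lambda>t. CLBINT y. exp (of_real t * cgf (w t) (y / sqrt (t * moment 2 (w t)))))"
  have "\<forall>\<^sub>F t in at_top. Re (G t) / (2 * pi) = p t x * sqrt (t * (- deriv (deriv \<phi>) (w t)))
                * exp (t * (\<phi> (w t) - w t * deriv \<phi> (w t)))"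
    using w_eq eventually_integrable_scaled_cgf[OF w_at_top] eventually_gt_at_top[of 0]
  proof eventually_elim
    case (elim t)
    define v where "v = w t"
    have v: "v > 0" and t: "t > 0" and x_eq: "x = t * moment 1 v"
      using elim by (auto simp: v_def)
    define \<sigma> where "\<sigma> = sqrt (t * moment 2 v)"
    have \<sigma>: "\<sigma> > 0" using t v moment_2_pos by (simp add: \<sigma>_def)
    define \<psi> where "\<psi> = (\<lambda>u. exp (of_real t * (exponent (of_real v) - exponent (of_real v - \<i> * of_real u))))"
    have \<psi>: "iexp (- (u * x)) * \<psi> u = exp (of_real t * cgf v u)" for u
      unfolding \<psi>_def cgf_eq_exponent[OF v] x_eq exp_add[symmetric] by (simp add: algebra_simps)
    have [measurable]: "cgf v \<in> borel_measurable borel"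
      using continuous_cgf[OF v] by (rule borel_measurable_continuous_onI)
    have "complex_integrable lborel (\<lambda>y. exp (of_real t * cgf v (0 + 1 / \<sigma> * y)))"
      using elim by (simp add: v_def \<sigma>_def)
    then have "complex_integrable lborel (\<lambda>u. exp (of_real t * cgf v u))"
      using \<sigma> by (subst (asm) lborel_integrable_real_affine_iff) auto
    then have "complex_integrable lborel (\<lambda>u. iexp (u * x) * exp (of_real t * cgf v u))"
      by (rule Bochner_Integration.integrable_bound) (auto simp: norm_mult)
    moreover have "iexp (u * x) * exp (of_real t * cgf v u) = \<psi> u" for u
      unfolding \<psi>[symmetric] mult.assoc[symmetric] exp_add[symmetric] by simp
    ultimately have int: "complex_integrable lborel \<psi>" by simp
    have "G t = \<sigma> *\<^sub>R (CLBINT u. exp (of_real t * cgf v u))"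
      using \<sigma> by (subst lborel_integral_real_affine[of "1 / \<sigma>" _ 0]) (auto simp: G_def v_def \<sigma>_def)
    also have "(CLBINT u. exp (of_real t * cgf v u)) = (CLBINT u. iexp (- (u * x)) * \<psi> u)"
      by (simp only: \<psi>)
    finally have G: "Re (G t) = \<sigma> * Re (CLBINT u. iexp (- (u * x)) * \<psi> u)" by simp
    have dens: "is_continuous_density M (T t) (\<lambda>y. exp (v * y - t * (LINT s|\<nu>. 1 - exp (- (v * s))))
        * (Re (CLBINT u. iexp (- (u * y)) * \<psi> u) / (2 * pi)))"
      unfolding \<psi>_def
    proof (rule tilted_continuous_density)
      show "prob_space M" "T t \<in> borel_measurable M"
        using assms(1) t by (simp_all add: subordinator_def levy_process_def)
      show "AE \<omega> in M. 0 \<le> T t \<omega>"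
        using assms(1) t by (intro subordinator_AE_nonneg) auto
      show "(LINT \<omega>|M. exp (- (l * T t \<omega>))) = exp (- (t * (LINT s|\<nu>. 1 - exp (- (l * s)))))" if "l > 0" for l
        using assms(2) t that \<phi>[of l] by (simp add: laplace_exponent_def)
    qed (use v int in \<open>auto simp: \<psi>_def\<close>)
    have "p t x = exp (v * x - t * \<phi> v) * (Re (CLBINT u. iexp (- (u * x)) * \<psi> u) / (2 * pi))"
      using fun_cong[OF continuous_density_eq[OF dens], of x] v by (simp add: assms(5)[OF t] \<phi>)
    moreover have "exp (v * x - t * \<phi> v) * exp (t * (\<phi> v - v * deriv \<phi> v)) = 1"
      using v by (simp add: d1 x_eq algebra_simps flip: exp_add)
    moreover have "sqrt (t * (- deriv (deriv \<phi>) v)) = \<sigma>"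
      using v by (simp add: d2 \<sigma>_def)
    ultimately show ?case
      unfolding v_def[symmetric] G by (simp add: mult_ac)
  qed
  moreover have "((\<lambda>t. Re (G t) / (2 * pi)) \<longlongrightarrow> (2 * pi) powr (- 1 / 2)) at_top"
  proof -
    have "((\<lambda>t. Re (G t) / (2 * pi)) \<longlongrightarrow> Re (of_real (sqrt (2 * pi))) / (2 * pi)) at_top"
      unfolding G_def by (intro tendsto_intros integral_scaled_cgf_tendsto w_at_top) simp
    moreover have "sqrt (2 * pi) / (2 * pi) = inverse (sqrt (2 * pi))"
      by (rule sqrt_divide_self_eq) simp
    moreover have "(2 * pi) powr (- 1 / 2) = inverse (sqrt (2 * pi))"
      using powr_minus[of "2 * pi" "1 / 2"] powr_half_sqrt[of "2 * pi"] by simp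
    ultimately show ?thesis by (simp only: Re_complex_of_real)
  qed
  ultimately show ?thesis by (rule Lim_transform_eventually[rotated])
qed

end
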